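(* Let $f$ be a transcendental entire function with a logarithmic singularity over $\infty$. Then the set of all $z\in\mathbb{C}$ such that $$\liminf_{n\to\infty} \frac{1}{n} \log \log (f^n)^\#(z) \geq \log\frac32$$ is dense in the Julia set $J(f)$.
   Context: $f^n$ denotes the $n$-th iterate of $f$. The Julia set $J(f)$ is the set of all points of $\mathbb{C}$ having no neighborhood in which the iterates $(f^n)_{n\in\mathbb{N}}$ form a normal family. For an entire function $g$, the spherical derivative is $g^\#(z)=\frac{|g'(z)|}{1+|g(z)|^2}$. The function $f$ has a logarithmic singularity over $\infty$ if there exist $R>0$ and a connected component $U$ of $\{z\in\mathbb{C}:|f(z)|>R\}$ such that $f:U\to\{w\in\mathbb{C}:|w|>R\}$ is a universal covering. The displayed inequality includes the requirement that $(f^n)^\#(z)>1$ for all large $n$, so that $\log\log (f^n)^\#(z)$ is defined for large $n$. *)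

theory Defs
  imports "HOL-Complex_Analysis.Complex_Analysis"
begin

definition transcendental_entire :: "(complex \<Rightarrow> complex) \<Rightarrow> bool" where
  "transcendental_entire f \<longleftrightarrow>
     f holomorphic_on UNIV \<and> \<not> (\<exists>p. \<forall>z. f z = poly p z)"

definition spherical_deriv :: "(complex \<Rightarrow> complex) \<Rightarrow> complex \<Rightarrow> real" where
  "spherical_deriv g z = norm (deriv g z) / (1 + (norm (g z))\<^sup>2)"

text \<open>The Riemann sphere is represented by \<^typ>\<open>complex option\<close>, with \<^term>\<open>None\<close> as the point at
  infinity. Its chordal metric is induced by the inverse stereographic projection onto the unit
  sphere of \<^typ>\<open>complex \<times> real\<close>, which sends infinity to the north pole.\<close>

fun sphere_point :: "complex option \<Rightarrow> complex \<times> real" where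
  "sphere_point None = (0, 1)"
| "sphere_point (Some z) =
     ((2 / (1 + (norm z)\<^sup>2)) *\<^sub>R z, ((norm z)\<^sup>2 - 1) / ((norm z)\<^sup>2 + 1))"

text \<open>Normality is with respect to the chordal metric, so that the locally uniform limit is a map
  into the sphere and may take the value infinity.\<close>

definition normal_family_on :: "complex set \<Rightarrow> (complex \<Rightarrow> complex) set \<Rightarrow> bool" where
  "normal_family_on U F \<longleftrightarrow>
     (\<forall>h :: nat \<Rightarrow> complex \<Rightarrow> complex. range h \<subseteq> F \<longrightarrow>
       (\<exists>(r :: nat \<Rightarrow> nat) (g :: complex \<Rightarrow> complex option). strict_mono r \<and>
          (\<forall>K. compact K \<and> K \<subseteq> U \<longrightarrow>
             uniform_limit K (\<lambda>k z. sphere_point (Some (h (r k) z)))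
               (\<lambda>z. sphere_point (g z)) sequentially)))"

definition julia_set :: "(complex \<Rightarrow> complex) \<Rightarrow> complex set" where
  "julia_set f =
     {z. \<not> (\<exists>U. open U \<and> z \<in> U \<and> normal_family_on U (range (\<lambda>n::nat. f ^^ n)))}"

definition universal_covering :: "complex set \<Rightarrow> (complex \<Rightarrow> complex) \<Rightarrow> complex set \<Rightarrow> bool" where
  "universal_covering U f V \<longleftrightarrow> covering_space U f V \<and> simply_connected U"

definition has_log_singularity_over_infinity :: "(complex \<Rightarrow> complex) \<Rightarrow> bool" where
  "has_log_singularity_over_infinity f \<longleftrightarrow>
     (\<exists>R>0. \<exists>U \<in> components {z. norm (f z) > R}. universal_covering U f {w. norm w > R})"

end

theory Submission
  imports Defs "HOL-Real_Asymp.Real_Asymp"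
begin

text \<open>
  Let \<open>U\<close> be the tract of the logarithmic singularity. Lifting the exponential through \<open>f\<close> gives a
  univalent map \<open>\<phi>\<close> of the right half-plane into \<open>U\<close> with \<open>f (\<phi> \<zeta>) = exp (\<zeta> + L)\<close>
  (\<open>log_tract_uniformization\<close>). If an orbit is written as \<open>z\<^sub>n = \<phi> \<zeta>\<^sub>n\<close>, then
  \<open>\<bar>f' z\<^sub>n\<bar> = \<bar>z\<^sub>n\<^sub>+\<^sub>1\<bar> / \<bar>\<phi>' \<zeta>\<^sub>n\<bar>\<close>, so an orbit expands strongly if it passes through points at which
  \<open>\<phi>'\<close> is small.

  How small it can be made is a matter of univalent functions. The Koebe quarter theorem on the
  half-plane says \<open>\<bar>\<phi>'\<bar> \<le> 2 \<bar>\<phi>\<bar> / Re\<close>; in particular \<open>\<phi> s = O(s\<^sup>2)\<close>. A point with \<open>\<bar>\<phi>\<bar> = exp t\<close> can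
  therefore be found at distance \<open>s \<approx> exp (t/2)\<close> from the imaginary axis, and there
  \<open>\<bar>\<phi>'\<bar> = O(exp (t/2))\<close>. The logarithms of \<open>\<phi>\<close> and \<open>\<phi>'\<close> are Bloch functions, and on the way from
  distance \<open>s\<close> down to a much smaller distance \<open>x\<close> one can choose the route such that they change by
  no more than \<open>O(sqrt (ln (s/x)))\<close>, which is \<open>O(sqrt t)\<close> (\<open>bloch_descent\<close>). Consequently, for
  \<open>t \<le> t' \<le> 2 t\<close> there are points with \<open>Re \<zeta> \<approx> t'\<close>, \<open>ln \<bar>\<phi>\<bar> = t + O(sqrt t)\<close> and
  \<open>ln \<bar>\<phi>'\<bar> \<le> t/2 + O(sqrt t)\<close> (\<open>univalent_half_plane_tame_rectangle\<close>).

  A nested sequence of compact sets then yields, for every sequence with \<open>t\<^sub>n \<le> t\<^sub>n\<^sub>+\<^sub>1 \<le> 2 t\<^sub>n\<close>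
  and \<open>t\<^sub>0\<close> large, an orbit
  with \<open>ln \<bar>z\<^sub>n\<bar> \<approx> t\<^sub>n\<close>, and up to errors \<open>O(sqrt t\<^sub>j)\<close> the logarithm of the spherical derivative of
  \<open>f\<^sup>n\<close> is at least
  \<open>(\<Sum>j<n. t\<^sub>j\<^sub>+\<^sub>1 - t\<^sub>j / 2) - 2 t\<^sub>n = (\<Sum>j<n. t\<^sub>j) / 2 - t\<^sub>n - t\<^sub>0\<close>. For a geometric sequence this is large
  as long as the ratio is smaller than \<open>3/2\<close>. The choice \<open>t\<^sub>n = \<theta> (3/2)\<^sup>n / (n + 3)\<close> stays just below
  the critical ratio: the quantity has the order \<open>(3/2)\<^sup>n / n\<^sup>2\<close>, which dominates the errors and has
  the required exponential growth rate (\<open>rapid_orbit_exists\<close>).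

  It remains to spread these points over the Julia set. Varying \<open>\<theta>\<close> gives uncountably many of
  them. In a ball that meets the Julia set the iterates omit at most one value by Montel's theorem,
  and the iterates have only countably many critical values; hence some point of the uncountable
  family is the image, under an iterate, of a noncritical point of the ball. The chain rule passes
  the growth on to that preimage, and a point at which the spherical derivatives are unbounded is in
  the Julia set by the easy half of Marty's criterion.
\<close>

section \<open>Area and the Bieberbach-Eilenberg inequality\<close>

unbundle no fps_syntax

text \<open>
  Areas of images are computed with the change of variables formula for maps of \<open>real^2\<close>, whereas
  univalent maps live on the complex
  plane; these two mutually inverse isometries connect them.
\<close>
definition v2c :: "real^2 \<Rightarrow> complex" where "v2c x = Complex (x $ 1) (x $ 2)"
definition c2v :: "complex \<Rightarrow> real^2" where "c2v z = vector [Re z, Im z]"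

lemma v2c_c2v [simp]: "v2c (c2v z) = z" and c2v_v2c [simp]: "c2v (v2c x) = x"
  by (simp_all add: v2c_def c2v_def vec_eq_iff forall_2)

lemma bounded_linear_c2v: "bounded_linear c2v"
  unfolding c2v_def
  by (rule linear_conv_bounded_linear[THEN iffD1], rule linearI) (simp_all add: vec_eq_iff forall_2)

lemma bounded_linear_v2c: "bounded_linear v2c"
  unfolding v2c_def
  by (rule linear_conv_bounded_linear[THEN iffD1], rule linearI) (simp_all add: complex_eq_iff)

lemma continuous_on_v2c [continuous_intros]: "continuous_on S v2c"
  using bounded_linear_v2c by (rule linear_continuous_on)

text \<open>By the Cauchy-Riemann equations the Jacobian of a holomorphic map is \<open>\<bar>W'\<bar>\<^sup>2\<close>.\<close>
lemma area_of_univalent_image: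
  fixes W :: "complex \<Rightarrow> complex" and S :: "(real^2) set"
  assumes hol: "W holomorphic_on A" and A: "open A" "v2c ` S \<subseteq> A"
    and inj: "inj_on W A" and S: "S = cbox a b"
  shows "c2v ` W ` v2c ` S \<in> lmeasurable"
    "measure lebesgue (c2v ` W ` v2c ` S) = integral S (\<lambda>x. (norm (deriv W (v2c x)))\<^sup>2)"
    "(\<lambda>x. (norm (deriv W (v2c x)))\<^sup>2) integrable_on S"
proof -
  define D where "D x = (\<lambda>h. c2v (deriv W (v2c x) * v2c h))" for x
  have der: "((\<lambda>x. c2v (W (v2c x))) has_derivative D x) (at x within S)" if "x \<in> S" for x
  proof -
    have "(W has_field_derivative deriv W (v2c x)) (at (v2c x))"
      using hol A that by (intro holomorphic_derivI) auto
    then have 1: "(W has_derivative (*) (deriv W (v2c x))) (at (v2c x))"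
      by (simp add: has_field_derivative_def)
    have 2: "(v2c has_derivative v2c) (at x within S)"
      using bounded_linear_v2c by (rule bounded_linear_imp_has_derivative)
    have 3: "((\<lambda>x. W (v2c x)) has_derivative (\<lambda>h. deriv W (v2c x) * v2c h)) (at x within S)"
      using has_derivative_compose[OF 2 1] by simp
    show ?thesis
      unfolding D_def by (rule bounded_linear.has_derivative[OF bounded_linear_c2v 3])
  qed
  have det: "\<bar>det (matrix (D x))\<bar> = (norm (deriv W (v2c x)))\<^sup>2" for x
  proof -
    have "det (matrix (D x)) = (Re (deriv W (v2c x)))\<^sup>2 + (Im (deriv W (v2c x)))\<^sup>2"
      by (simp add: det_2 matrix_def D_def c2v_def v2c_def axis_def power2_eq_square)
    then show ?thesis by (simp add: cmod_power2)
  qed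
  have inj': "inj_on (\<lambda>x. c2v (W (v2c x))) S"
  proof (rule inj_onI)
    fix x y assume xy: "x \<in> S" "y \<in> S" "c2v (W (v2c x)) = c2v (W (v2c y))"
    have "W (v2c x) = W (v2c y)" using arg_cong[OF xy(3), of v2c] by simp
    moreover have "v2c x \<in> A" "v2c y \<in> A" using A(2) xy by auto
    ultimately have "v2c x = v2c y" using inj by (meson inj_onD)
    from arg_cong[OF this, of c2v] show "x = y" by simp
  qed
  have "continuous_on A (deriv W)"
    using hol A by (intro holomorphic_on_imp_continuous_on holomorphic_deriv)
  then have "continuous_on S (\<lambda>x. deriv W (v2c x))"
    using A(2) continuous_on_compose2[OF _ continuous_on_v2c] by blast
  then have "continuous_on S (\<lambda>x. (norm (deriv W (v2c x)))\<^sup>2)"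
    by (intro continuous_intros)
  then show int: "(\<lambda>x. (norm (deriv W (v2c x)))\<^sup>2) integrable_on S"
    unfolding S by (rule integrable_continuous)
  have Sl: "S \<in> sets lebesgue" using S by simp
  have eq: "(\<lambda>x. c2v (W (v2c x))) ` S = c2v ` W ` v2c ` S" by (simp add: image_image)
  show "c2v ` W ` v2c ` S \<in> lmeasurable"
    using measurable_differentiable_image_eq[OF Sl der inj'] int det eq by simp
  show "measure lebesgue (c2v ` W ` v2c ` S) = integral S (\<lambda>x. (norm (deriv W (v2c x)))\<^sup>2)"
    using measure_differentiable_image_eq[OF Sl der inj'] int det eq by simp
qed

lemma integral_v2c_iterated:
  fixes h :: "complex \<Rightarrow> real"
  assumes "a \<le> b" "c \<le> d"
    and cont: "continuous_on {z. a \<le> Re z \<and> Re z \<le> b \<and> c \<le> Im z \<and> Im z \<le> d} h"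
  shows "integral (cbox (vector [a, c]) (vector [b, d])) (\<lambda>x. h (v2c x))
       = integral {a..b} (\<lambda>u. integral {c..d} (\<lambda>v. h (Complex u v)))"
proof -
  define g :: "real \<times> real \<Rightarrow> real^2" where "g p = vector [fst p, snd p]" for p
  define k :: "real^2 \<Rightarrow> real \<times> real" where "k x = (x $ 1, x $ 2)" for x
  have gk: "g (k x) = x" "k (g p) = p" for x p
    by (simp_all add: g_def k_def vec_eq_iff forall_2)
  have gim: "g ` cbox u v = cbox (g u) (g v)" for u v
  proof -
    have *: "x \<in> cbox u v \<longleftrightarrow> g x \<in> cbox (g u) (g v)" for x
      by (cases u; cases v; cases x) (auto simp: g_def cbox_Pair_eq mem_box_cart forall_2)
    then have "x \<in> cbox (g u) (g v) \<Longrightarrow> x \<in> g ` cbox u v" for x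
      using gk(1)[of x] by (intro image_eqI[of _ _ "k x"]) auto
    with * show ?thesis by blast
  qed
  have kim: "k ` cbox u v = cbox (k u) (k v)" for u v
  proof -
    have "cbox u v = g ` cbox (k u) (k v)" by (simp add: gim gk)
    then show ?thesis by (simp add: image_image gk)
  qed
  have hi: "((\<lambda>p. h (Complex (fst p) (snd p))) has_integral 
      integral (cbox (a,c) (b,d)) (\<lambda>p. h (Complex (fst p) (snd p)))) (cbox (a,c) (b,d))"
  proof (rule integrable_integral, rule integrable_continuous)
    show "continuous_on (cbox (a,c) (b,d)) (\<lambda>p. h (Complex (fst p) (snd p)))"
      by (rule continuous_on_compose2[OF cont, where f="\<lambda>p. Complex (fst p) (snd p)"])
        (auto simp: Complex_eq cbox_Pair_eq intro!: continuous_intros)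
  qed
  have "((\<lambda>x. h (Complex (fst (k x)) (snd (k x)))) has_integral 
     (1 / 1) *\<^sub>R integral (cbox (a,c) (b,d)) (\<lambda>p. h (Complex (fst p) (snd p)))) (g ` cbox (a,c) (b,d))"
  proof (rule has_integral_twiddle[OF _ _ _ _ _ _ _ hi])
    show "k (g x) = x" "g (k y) = y" for x y by (simp_all add: gk)
    show "continuous (at x) k" for x :: "real^2"
      unfolding k_def by (intro continuous_intros)
    show "\<exists>w z. k ` cbox u v = cbox w z" "\<exists>w z. g ` cbox u' v' = cbox w z" for u v u' v'
      using kim gim by blast+
    show "measure lborel (k ` cbox u v) = 1 * measure lborel (cbox u v)" for u v :: "real^2"
      unfolding kim
      using interval_ne_empty_cart(1)[of u v]
      by (auto simp add: k_def content_Pair content_cbox_if_cart UNIV_2 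
        content_real_if not_less forall_2 exhaust_2)
  qed auto
  then have "integral (cbox (vector [a, c]) (vector [b, d])) (\<lambda>x. h (v2c x)) =
     integral (cbox (a,c) (b,d)) (\<lambda>p. h (Complex (fst p) (snd p)))"
    unfolding gim by (simp add: integral_unique g_def k_def v2c_def)
  also have "\<dots> = integral {a..b} (\<lambda>u. integral {c..d} (\<lambda>v. h (Complex u v)))"
  proof -
    have "continuous_on (cbox (a,c) (b,d)) (\<lambda>p. h (Complex (fst p) (snd p)))"
      by (rule continuous_on_compose2[OF cont, where f="\<lambda>p. Complex (fst p) (snd p)"])
        (auto simp: Complex_eq cbox_Pair_eq intro!: continuous_intros)
    from integral_prod_continuous[OF this] show ?thesis by simp
  qed
  finally show ?thesis .
qed


text \<open>
  An area argument in logarithmic coordinates. Put \<open>W t = ln (p (exp t))\<close> on the left half-plane, so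
  that \<open>W (t + 2\<pi>i) = W t + 2\<pi>i\<close>. Since \<open>p\<close> is injective and \<open>p z * p w\<close> is never \<open>1\<close>, the images of a
  rectangle of width about \<open>N\<close> and height \<open>2\<pi>m\<close> under \<open>W\<close> and under \<open>2\<pi>mi - W\<close> are disjoint. Each has
  area at least about \<open>2\<pi>m * N\<close>, because the mean of \<open>W'\<close> is \<open>1\<close>. Both lie in a strip of half-width
  about \<open>N - ln \<bar>p' 0\<bar>\<close>. Comparing areas for large \<open>m\<close> gives \<open>ln \<bar>p' 0\<bar> \<le> 0\<close>.
\<close>
lemma bieberbach_eilenberg_univalent:
  fixes p :: "complex \<Rightarrow> complex"
  assumes holp: "p holomorphic_on ball 0 1" and injp: "inj_on p (ball 0 1)" and p0: "p 0 = 0"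
    and disj: "\<And>z w. z \<in> ball 0 1 \<Longrightarrow> w \<in> ball 0 1 \<Longrightarrow> p z * p w \<noteq> 1"
  shows "norm (deriv p 0) \<le> 1"
proof -
  have p'0: "deriv p 0 \<noteq> 0"
    using holomorphic_injective_imp_regular[OF holp _ injp] by simp
  define k where "k z = (if z = 0 then deriv p 0 else (p z - p 0) / (z - 0))" for z
  have "k holomorphic_on ball 0 1"
    unfolding k_def using pole_lemma[OF holp, of 0] by simp
  moreover have k_nz: "k z \<noteq> 0" if "z \<in> ball 0 1" for z
    using p'0 that inj_onD[OF injp, of z 0] by (auto simp: k_def p0)
  ultimately obtain l where holl: "l holomorphic_on ball 0 1"
    and l: "\<And>z. z \<in> ball 0 1 \<Longrightarrow> k z = exp (l z)"
    using contractible_imp_holomorphic_log[of k "ball 0 1"] convex_imp_contractible[OF convex_ball]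
    by metis
  have p_exp: "p z = z * exp (l z)" if "z \<in> ball 0 1" for z
    using l[OF that] by (auto simp: k_def p0 field_simps split: if_splits)
  define L where "L = Re (l 0)"
  have norm_a: "norm (deriv p 0) = exp L"
    using l[of 0] by (simp add: k_def L_def norm_exp_eq_Re)
  have "L \<le> 0"
  proof (rule ccontr)
    assume "\<not> L \<le> 0"
    define d where "d = L / 4"
    have d: "d > 0" "L = 4 * d" using \<open>\<not> L \<le> 0\<close> by (auto simp: d_def)
    have "continuous_on (ball 0 1) l"
      using holl by (rule holomorphic_on_imp_continuous_on)
    then have "isCont l 0"
      by (simp add: continuous_on_eq_continuous_at)
    then obtain r where r: "r > 0" "\<And>z. norm z < r \<Longrightarrow> norm (l z - l 0) < d"
      using d unfolding continuous_at_eps_delta dist_norm by (metis diff_zero)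
    \<comment> \<open>a left margin \<open>-N\<close> so far out that \<open>ln (p z / z)\<close> is within \<open>d\<close> of its value at \<open>0\<close>; the right margin is \<open>-d\<close>\<close>
    define N where "N = max (d + 1) (1 - ln r)"
    have N: "N > d" "exp (-N) < r" "exp (-N) < 1" 
    proof -
      show "N > d" by (simp add: N_def)
      have "-N < ln r" by (simp add: N_def)
      then show "exp (-N) < r" using r(1) by (metis exp_less_cancel_iff exp_ln)
      show "exp (-N) < 1" using d by (simp add: N_def)
    qed
    define M where "M = N - 3 * d"
    define e where "e = exp (-N)"
    have e: "e > 0" "e < r" "e < 1" using N by (auto simp: e_def)
    have eM: "exp (-M) \<le> norm (p z)" if "norm z = e" for z
    proof -
      have "norm (p z) = e * exp (Re (l z))"
        using p_exp[of z] that e by (simp add: norm_mult norm_exp_eq_Re)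
      moreover have "\<bar>Re (l z) - L\<bar> < d"
        using r(2)[of z] that e abs_Re_le_cmod[of "l z - l 0"] by (simp add: L_def)
      then have "exp (3 * d) \<le> exp (Re (l z))" using d by simp
      moreover have "exp (-M) = e * exp (3 * d)"
        by (simp add: M_def e_def flip: exp_add)
      ultimately show ?thesis using e by (simp add: mult_left_mono)
    qed
    \<comment> \<open>small values are taken near \<open>0\<close> only, so elsewhere \<open>\<bar>p\<bar>\<close> and \<open>1 / \<bar>p\<bar>\<close> are bounded below\<close>
    have cover: "ball 0 (exp (-M)) \<subseteq> p ` ball 0 e"
    proof -
      have sub: "ball 0 e \<subseteq> ball (0::complex) 1" "cball 0 e \<subseteq> ball (0::complex) 1" using e by auto
      have "ball (p 0) (exp (-M)) \<subseteq> p ` ball 0 e"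
      proof (rule ball_subset_open_map_image)
        show "continuous_on (closure (ball 0 e)) p"
          using holomorphic_on_imp_continuous_on[OF holp] continuous_on_subset sub e by (auto simp: closure_ball)
        show "open (p ` interior (ball 0 e))"
          using open_mapping_thm3[of p "ball 0 e"] holomorphic_on_subset[OF holp] inj_on_subset[OF injp] sub 
          by simp
        show "exp (-M) \<le> norm (p z - p 0)" if "z \<in> frontier (ball 0 e)" for z
          using that eM[of z] e p0 by (simp add: frontier_ball)
      qed (use e in auto)
      then show ?thesis by (simp add: p0)
    qed
    define A where "A = {t. Re t < 0}"
    have A: "open A" by (simp add: A_def open_halfspace_Re_lt)
    have expA: "exp t \<in> ball 0 1" if "t \<in> A" for t
      using that by (simp add: A_def)
    define W where "W t = t + l (exp t)" for t
    have holW: "W holomorphic_on A"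
      unfolding W_def
      by (intro holomorphic_intros holomorphic_on_compose_gen[OF _ holl, unfolded o_def]) 
         (use expA in auto)
    have expW: "exp (W t) = p (exp t)" if "t \<in> A" for t
      using p_exp[OF expA[OF that]] by (simp add: W_def exp_add)
    have injW: "inj_on W A"
    proof (rule inj_onI)
      fix s t assume st: "s \<in> A" "t \<in> A" "W s = W t"
      then have "p (exp s) = p (exp t)" using expW by metis
      then have "exp s = exp t" using injp expA st by (meson inj_onD)
      then show "s = t" using st(3) by (simp add: W_def)
    qed
    have derW: "deriv W t = 1 + exp t * deriv l (exp t)" if "t \<in> A" for t
    proof -
      have "(l has_field_derivative deriv l (exp t)) (at (exp t))"
        using holomorphic_derivI[OF holl open_ball expA[OF that]] by simp
      then have "((\<lambda>t. l (exp t)) has_field_derivative deriv l (exp t) * exp t) (at t)"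
        by (rule DERIV_chain2) (auto intro!: derivative_eq_intros)
      then have "(W has_field_derivative 1 + deriv l (exp t) * exp t) (at t)"
        unfolding W_def by (intro derivative_intros)
      then show ?thesis by (simp add: DERIV_imp_deriv)
    qed
    have ReW: "\<bar>Re (W t)\<bar> \<le> M" if "t \<in> A" "-N \<le> Re t" for t
    proof -
      let ?z = "exp t"
      have z: "?z \<in> ball 0 1" "?z \<notin> ball 0 e"
        using expA that by (auto simp: e_def)
      have sub: "w \<in> ball 0 1" if "w \<in> ball 0 e" for w :: complex using that e by auto
      have "p ?z \<notin> ball 0 (exp (-M))"
      proof
        assume "p ?z \<in> ball 0 (exp (-M))"
        then obtain w where w: "w \<in> ball 0 e" "p ?z = p w" using cover by blast
        then show False using z inj_onD[OF injp w(2)] sub by auto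
      qed
      moreover have "inverse (p ?z) \<notin> ball 0 (exp (-M))"
      proof
        assume "inverse (p ?z) \<in> ball 0 (exp (-M))"
        then obtain w where w: "w \<in> ball 0 e" "inverse (p ?z) = p w" using cover by blast
        moreover have "p ?z \<noteq> 0" using expW[OF that(1)] exp_not_eq_zero[of "W t"] by simp
        ultimately show False using disj[OF z(1) sub[OF w(1)]] right_inverse[of "p ?z"] by simp
      qed
      moreover have "norm (p ?z) = exp (Re (W t))"
        using expW[OF that(1)] by (metis norm_exp_eq_Re)
      ultimately show ?thesis by (auto simp: norm_inverse not_less simp flip: exp_minus)
    qed
    obtain B where B: "B > 0" "\<And>z. norm z \<le> exp (-d) \<Longrightarrow> norm (l z) \<le> B"
    proof -
      have "compact (l ` cball 0 (exp (-d)))"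
        using order_le_less_trans[OF _ exp_less_one_iff[THEN iffD2, of "-d"]] d
        by (intro compact_continuous_image continuous_on_subset[OF \<open>continuous_on (ball 0 1) l\<close>]) auto
      then have "bounded (l ` cball 0 (exp (-d)))" by (rule compact_imp_bounded)
      then show ?thesis using that unfolding bounded_pos by auto
    qed
    have "0 \<le> M"
      using ReW[of "-d"] d N by (simp add: A_def)
    have key: "real m * (d * (2 * pi)) \<le> M * B" if m: "m > 0" for m :: nat
    proof -
      define T where "T = 2 * pi * real m"
      have T: "T > 0" using m by (simp add: T_def)
      have expT: "exp (Complex 0 T) = 1"
        using cis_multiple_2pi[of "real m"] unfolding cis_conv_exp
        by (simp add: Complex_eq T_def)
      define V where "V t = Complex 0 T - W t" for t
      have holV: "V holomorphic_on A" unfolding V_def by (intro holomorphic_intros holW)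
      have injV: "inj_on V A" using injW by (auto simp: V_def inj_on_def)
      have derV: "deriv V t = - deriv W t" if "t \<in> A" for t
      proof -
        have "(W has_field_derivative deriv W t) (at t)"
          using holomorphic_derivI[OF holW A that] by simp
        then have "(V has_field_derivative 0 - deriv W t) (at t)"
          unfolding V_def by (intro derivative_intros)
        then show ?thesis by (simp add: DERIV_imp_deriv)
      qed
      define S where "S = cbox (vector [-N, 0] :: real^2) (vector [-d, T])"
      have inS: "v2c x \<in> A \<and> -N \<le> Re (v2c x) \<and> Re (v2c x) \<le> -d \<and> 0 \<le> Im (v2c x) \<and> Im (v2c x) \<le> T" if "x \<in> S" for x
        using that d by (simp add: S_def mem_box_cart forall_2 v2c_def A_def)
      then have SA: "v2c ` S \<subseteq> A" by blast
      note areaW = area_of_univalent_image[OF holW A SA injW S_def]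
      note areaV = area_of_univalent_image[OF holV A SA injV S_def]
      have ImW: "\<bar>Im (W t) - Im t\<bar> \<le> B" if "Re t \<le> -d" for t
        using abs_Im_le_cmod[of "l (exp t)"] B(2)[of "exp t"] that by (simp add: W_def)
      define R where "R = cbox (vector [-M, -B] :: real^2) (vector [M, T + B])"
      have inR: "c2v ` W ` v2c ` S \<subseteq> R" "c2v ` V ` v2c ` S \<subseteq> R"
      proof -
        have "c2v (W t) \<in> R \<and> c2v (V t) \<in> R" if "t \<in> v2c ` S" for t
        proof -
          have t: "t \<in> A" "-N \<le> Re t" "Re t \<le> -d" "0 \<le> Im t" "Im t \<le> T" using that inS by auto
          have "\<bar>Re (W t)\<bar> \<le> M" "\<bar>Im (W t) - Im t\<bar> \<le> B" using ReW ImW t by auto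
          then have "- M \<le> Re (W t)" "Re (W t) \<le> M" "- B \<le> Im (W t)" "Im (W t) \<le> T + B"
            using t by linarith+
          then show ?thesis
            by (simp add: R_def mem_box_cart forall_2 c2v_def V_def) 
        qed
        then show "c2v ` W ` v2c ` S \<subseteq> R" "c2v ` V ` v2c ` S \<subseteq> R" by auto
      qed
      have disjoint: "c2v ` W ` v2c ` S \<inter> c2v ` V ` v2c ` S = {}"
      proof -
        have False if st: "s \<in> A" "t \<in> A" "c2v (W s) = c2v (V t)" for s t
        proof -
          have "W s = V t" using arg_cong[OF st(3), of v2c] by simp
          then have "exp (W s) * exp (W t) = 1"
            by (simp add: V_def exp_diff expT)
          then show False using disj[OF expA expA] st by (simp add: expW)
        qed
        with SA show ?thesis by blast
      qed
      have measR: "measure lebesgue R = 2 * M * (T + 2 * B)"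
        using T B(1) \<open>0 \<le> M\<close> interval_ne_empty_cart(1)[of "vector [-M, -B] :: real^2" "vector [M, T + B]"]
        by (simp add: R_def content_cbox_if_cart UNIV_2 forall_2)
      define I where "I = integral S (\<lambda>x. (norm (deriv W (v2c x)))\<^sup>2)"
      have "integral S (\<lambda>x. (norm (deriv V (v2c x)))\<^sup>2) = I"
        unfolding I_def by (rule integral_cong) (use derV inS in auto)
      then have "2 * I = measure lebesgue (c2v ` W ` v2c ` S \<union> c2v ` V ` v2c ` S)"
        using measure_Un3[OF areaW(1) areaV(1)] disjoint areaW(2) areaV(2) by (simp add: I_def)
      also have "\<dots> \<le> measure lebesgue R"
        using areaW(1) areaV(1) inR by (intro measure_mono_fmeasurable) (auto simp: R_def)
      finally have upper: "2 * I \<le> 2 * M * (T + 2 * B)" using measR by simp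
      \<comment> \<open>\<open>\<bar>1 + c\<bar>\<^sup>2 \<ge> 1 + 2 Re c\<close>, and the right-hand side can be integrated: apart from the summand \<open>1\<close> it is the derivative of a periodic function along vertical lines\<close>
      define h where "h t = 1 + 2 * Re (exp t * deriv l (exp t))" for t
      have conth: "continuous_on A h"
      proof -
        have "continuous_on (ball 0 1) (deriv l)"
          by (rule holomorphic_on_imp_continuous_on[OF holomorphic_deriv[OF holl open_ball]])
        moreover have "continuous_on A exp" by (rule continuous_on_exp[OF continuous_on_id])
        ultimately have "continuous_on A (\<lambda>t. deriv l (exp t))"
          using expA continuous_on_compose2 by blast
        then show ?thesis unfolding h_def by (intro continuous_intros)
      qed
      have box_sub: "{z. -N \<le> Re z \<and> Re z \<le> -d \<and> 0 \<le> Im z \<and> Im z \<le> T} \<subseteq> A"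
        using d by (auto simp: A_def)
      have "integral S (\<lambda>x. h (v2c x)) = integral {-N..-d} (\<lambda>u. integral {0..T} (\<lambda>v. h (Complex u v)))"
        unfolding S_def using N T by (intro integral_v2c_iterated continuous_on_subset[OF conth box_sub]) auto
      also have "\<dots> = integral {-N..-d} (\<lambda>u. T)"
      proof (rule integral_cong)
        fix u assume u: "u \<in> {-N..-d}"
        define G where "G v = v + 2 * Im (l (exp (Complex u v)))" for v
        have "(G has_vector_derivative h (Complex u v)) (at v within {0..T})" for v
        proof -
          have uA: "Complex u v \<in> A" using u d by (simp add: A_def)
          have "((\<lambda>v. Complex u v) has_vector_derivative \<i>) (at v within {0..T})"
            unfolding Complex_eq by (auto intro!: derivative_eq_intros)
          moreover have "((\<lambda>t. l (exp t)) has_field_derivative deriv l (exp (Complex u v)) * exp (Complex u v)) 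
              (at (Complex u v))"
            using holomorphic_derivI[OF holl open_ball expA[OF uA]]
            by (rule DERIV_chain2) (auto intro!: derivative_eq_intros)
          ultimately have "((\<lambda>v. l (exp (Complex u v))) has_vector_derivative 
              (\<i> * (deriv l (exp (Complex u v)) * exp (Complex u v)))) (at v within {0..T})"
            using field_vector_diff_chain_within[of "\<lambda>v. Complex u v" \<i> v "{0..T}" "\<lambda>t. l (exp t)"]
            by (simp add: o_def has_field_derivative_at_within)
          then have "((\<lambda>v. Im (l (exp (Complex u v)))) has_vector_derivative 
              Im (\<i> * (deriv l (exp (Complex u v)) * exp (Complex u v)))) (at v within {0..T})"
            by (rule bounded_linear.has_vector_derivative[OF bounded_linear_Im])
          then show ?thesis unfolding G_def h_def
            by (auto intro!: derivative_eq_intros simp: mult.commute)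
        qed
        then have "((\<lambda>v. h (Complex u v)) has_integral (G T - G 0)) {0..T}"
          using T by (intro fundamental_theorem_of_calculus) auto
        moreover have "Complex u T = Complex u 0 + Complex 0 T" by (simp add: complex_eq_iff)
        then have "exp (Complex u T) = exp (Complex u 0)" by (simp add: exp_add expT)
        then have "G T - G 0 = T" by (simp add: G_def)
        ultimately show "integral {0..T} (\<lambda>v. h (Complex u v)) = T" by (simp add: integral_unique)
      qed
      also have "\<dots> = (N - d) * T" using N by simp
      finally have "integral S (\<lambda>x. h (v2c x)) = (N - d) * T" .
      moreover have "integral S (\<lambda>x. h (v2c x)) \<le> I"
        unfolding I_def
      proof (rule integral_le)
        show "(\<lambda>x. h (v2c x)) integrable_on S"
          unfolding S_def
        proof (rule integrable_continuous, rule continuous_on_compose2[OF conth continuous_on_v2c])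
          show "v2c ` cbox (vector [-N, 0]) (vector [-d, T]) \<subseteq> A" using SA unfolding S_def .
        qed
        show "(\<lambda>x. (norm (deriv W (v2c x)))\<^sup>2) integrable_on S" by (rule areaW(3))
        fix x assume "x \<in> S"
        then have "deriv W (v2c x) = 1 + exp (v2c x) * deriv l (exp (v2c x))"
          using derW inS by blast
        moreover have "1 + 2 * Re c \<le> (norm (1 + c))\<^sup>2" for c
          unfolding cmod_power2 by (simp add: power2_eq_square algebra_simps)
        ultimately show "h (v2c x) \<le> (norm (deriv W (v2c x)))\<^sup>2" unfolding h_def by (simp only:)
      qed
      ultimately have "(N - d) * T \<le> M * (T + 2 * B)" using upper by linarith
      then have "d * T \<le> M * B" by (simp add: M_def algebra_simps)
      moreover have "real m * (d * (2 * pi)) = d * T" unfolding T_def by (simp only: mult_ac)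
      ultimately show ?thesis by (simp only:)
    qed
    obtain m :: nat where m: "M * B / (d * (2 * pi)) < real m" using reals_Archimedean2 by blast
    have "M * B < real m * (d * (2 * pi))"
      using m d by (subst (asm) pos_divide_less_eq) auto
    also have "\<dots> \<le> real (Suc m) * (d * (2 * pi))"
      using d by (intro mult_right_mono) auto
    also have "\<dots> \<le> M * B" by (rule key) simp
    finally show False by simp
  qed
  then show ?thesis using norm_a by simp
qed

section \<open>Koebe distortion\<close>

text \<open>
  The square root \<open>q\<close> of \<open>F / F 0\<close> with \<open>q 0 = 1\<close> never takes two opposite values, and the Moebius
  transformation \<open>(1 - q) / (1 + q)\<close> turns opposite values into reciprocal ones; the previous bound
  applies to it. The constant \<open>4\<close> is sharp, and it is what makes the final growth rate \<open>ln (3/2)\<close>.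
\<close>
lemma koebe_quarter_unit:
  assumes holF: "F holomorphic_on ball 0 1" and injF: "inj_on F (ball 0 1)"
    and nz: "\<And>z. z \<in> ball 0 1 \<Longrightarrow> F z \<noteq> 0"
  shows "norm (deriv F 0) \<le> 4 * norm (F 0)"
proof -
  have "(\<lambda>z. F z / F 0) holomorphic_on ball 0 1" 
    using nz[of 0] by (intro holomorphic_intros holF) auto
  moreover have "F z / F 0 \<noteq> 0" if "z \<in> ball 0 1" for z using nz that by simp
  ultimately obtain g where g: "g holomorphic_on ball 0 1" "\<And>z. z \<in> ball 0 1 \<Longrightarrow> F z / F 0 = (g z)\<^sup>2"
    using contractible_imp_holomorphic_sqrt[OF _ convex_imp_contractible[OF convex_ball]] by blast
  have "(g 0)\<^sup>2 = 1" using g(2)[of 0] nz[of 0] by simp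
  then have "g 0 \<noteq> 0" by auto
  define q where "q z = g 0 * g z" for z
  have q0: "q 0 = 1" using \<open>(g 0)\<^sup>2 = 1\<close> by (simp add: q_def power2_eq_square)
  have holq: "q holomorphic_on ball 0 1" unfolding q_def by (intro holomorphic_intros g(1))
  have Fq: "F z = F 0 * (q z)\<^sup>2" if "z \<in> ball 0 1" for z
    using g(2)[OF that] nz[of 0] \<open>(g 0)\<^sup>2 = 1\<close> by (simp add: q_def power_mult_distrib field_simps)
  have q_nz: "q z \<noteq> 0" if "z \<in> ball 0 1" for z
    using Fq[OF that] nz[OF that] by auto
  have q_anti: "q z + q w \<noteq> 0" if "z \<in> ball 0 1" "w \<in> ball 0 1" for z w
  proof
    assume sum0: "q z + q w = 0"
    then have "q z = - q w" by (simp add: eq_neg_iff_add_eq_0)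
    then have "F z = F w" using Fq[OF that(1)] Fq[OF that(2)] by simp
    then have "z = w" using injF that by (meson inj_onD)
    then show False using sum0 q_nz[OF that(1)] by simp
  qed
  have injq: "inj_on q (ball 0 1)"
  proof (rule inj_onI)
    fix z w assume zw: "z \<in> ball 0 1" "w \<in> ball 0 1" "q z = q w"
    then have "F z = F w" using Fq[OF zw(1)] Fq[OF zw(2)] by simp
    then show "z = w" using injF zw by (meson inj_onD)
  qed
  have q1: "1 + q z \<noteq> 0" if "z \<in> ball 0 1" for z
    using q_anti[of 0 z] that q0 by simp
  define p where "p z = (1 - q z) / (1 + q z)" for z
  have holp: "p holomorphic_on ball 0 1"
    unfolding p_def using q1 by (intro holomorphic_intros holq) auto
  have injp: "inj_on p (ball 0 1)"
  proof (rule inj_onI)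
    fix z w assume zw: "z \<in> ball 0 1" "w \<in> ball 0 1" "p z = p w"
    then have "q z = q w" using q1[OF zw(1)] q1[OF zw(2)] by (simp add: p_def frac_eq_eq algebra_simps)
    then show "z = w" using injq zw by (meson inj_onD)
  qed
  have "p z * p w \<noteq> 1" if "z \<in> ball 0 1" "w \<in> ball 0 1" for z w
  proof
    assume "p z * p w = 1"
    then have "(1 - q z) * (1 - q w) = (1 + q z) * (1 + q w)"
      using q1[OF that(1)] q1[OF that(2)] by (simp add: p_def)
    then have "2 * (q z + q w) = 0" by (simp add: algebra_simps)
    then have "q z + q w = 0" by (simp only: mult_eq_0_iff) simp
    then show False using q_anti that by blast
  qed
  then have "norm (deriv p 0) \<le> 1"
    by (intro bieberbach_eilenberg_univalent holp injp) (auto simp: p_def q0)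
  moreover have "deriv F 0 = - 4 * F 0 * deriv p 0"
  proof -
    have dq: "(q has_field_derivative deriv q 0) (at 0)"
      using holomorphic_derivI[OF holq] by simp
    have "(p has_field_derivative - deriv q 0 / 2) (at 0)"
      unfolding p_def by (auto intro!: derivative_eq_intros dq simp: q0 field_simps)
    then have 1: "deriv p 0 = - deriv q 0 / 2" by (rule DERIV_imp_deriv)
    have "((\<lambda>z. F 0 * (q z)\<^sup>2) has_field_derivative F 0 * (2 * deriv q 0)) (at 0)"
      by (auto intro!: derivative_eq_intros dq simp: q0)
    then have "(F has_field_derivative F 0 * (2 * deriv q 0)) (at 0)"
      by (rule has_field_derivative_transform_within_open[of _ _ _ "ball 0 1"]) (use Fq[symmetric] in \<open>auto simp del: mem_ball\<close>)
    then have "deriv F 0 = F 0 * (2 * deriv q 0)" by (rule DERIV_imp_deriv)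
    with 1 show ?thesis by simp
  qed
  ultimately show ?thesis by (simp add: norm_mult mult_left_le mult.commute)
qed

lemma koebe_quarter_ball:
  assumes holF: "F holomorphic_on ball a r" and injF: "inj_on F (ball a r)" and r: "r > 0"
    and nz: "\<And>z. z \<in> ball a r \<Longrightarrow> F z \<noteq> 0"
  shows "r * norm (deriv F a) \<le> 4 * norm (F a)"
proof -
  define m where "m z = a + of_real r * z" for z
  have m: "m z \<in> ball a r" if "z \<in> ball 0 1" for z
    using that r by (simp add: m_def dist_norm norm_mult)
  have "norm (deriv (F \<circ> m) 0) \<le> 4 * norm ((F \<circ> m) 0)"
  proof (rule koebe_quarter_unit)
    show "F \<circ> m holomorphic_on ball 0 1"
    proof (rule holomorphic_on_compose_gen[OF _ holF])
      show "m holomorphic_on ball 0 1" unfolding m_def by (intro holomorphic_intros)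
      show "m ` ball 0 1 \<subseteq> ball a r" using m by blast
    qed
    show "inj_on (F \<circ> m) (ball 0 1)"
    proof (rule comp_inj_on[OF _ inj_on_subset[OF injF]])
      show "inj_on m (ball 0 1)" using r by (simp add: m_def inj_on_def)
      show "m ` ball 0 1 \<subseteq> ball a r" using m by blast
    qed
    show "(F \<circ> m) z \<noteq> 0" if "z \<in> ball 0 1" for z using nz[OF m[OF that]] by simp
  qed
  moreover have "deriv (F \<circ> m) 0 = deriv F a * of_real r"
  proof -
    have "(F has_field_derivative deriv F a) (at (m 0))"
      using holomorphic_derivI[OF holF, of a] r by (simp add: m_def)
    moreover have "(m has_field_derivative of_real r) (at 0)"
      unfolding m_def by (auto intro!: derivative_eq_intros)
    ultimately have "(F \<circ> m has_field_derivative deriv F a * of_real r) (at 0)"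
      by (rule DERIV_chain)
    then show ?thesis by (rule DERIV_imp_deriv)
  qed
  ultimately show ?thesis using r by (simp add: norm_mult m_def mult.commute)
qed

text \<open>The Cayley map of the disc onto the half-plane that sends \<open>0\<close> to \<open>z\<close> has derivative \<open>2 Re z\<close> at \<open>0\<close>.\<close>
lemma koebe_quarter_half_plane:
  assumes hol: "F holomorphic_on {z. Re z > 0}" and inj: "inj_on F {z. Re z > 0}"
    and nz: "\<And>z. Re z > 0 \<Longrightarrow> F z \<noteq> 0" and z: "Re z > 0"
  shows "Re z * norm (deriv F z) \<le> 2 * norm (F z)"
proof -
  define m where "m w = Complex 0 (Im z) + of_real (Re z) * ((1 + w) / (1 - w))" for w
  have Rem: "Re ((1 + w) / (1 - w)) > 0" if "w \<in> ball 0 1" for w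
  proof -
    have "(Re w)\<^sup>2 + (Im w)\<^sup>2 < 1" using that by (simp add: cmod_def)
    moreover have "w \<noteq> 1" using that by auto
    then have "norm (1 - w) > 0" by simp
    then have "(1 - Re w)\<^sup>2 + (Im w)\<^sup>2 > 0" unfolding cmod_def by simp
    moreover have "Re ((1 + w) / (1 - w)) = (1 - ((Re w)\<^sup>2 + (Im w)\<^sup>2)) / ((1 - Re w)\<^sup>2 + (Im w)\<^sup>2)"
      unfolding Re_divide by (simp add: power2_eq_square algebra_simps)
    ultimately show ?thesis by (metis diff_gt_0_iff_gt divide_pos_pos)
  qed
  have m: "Re (m w) > 0" if "w \<in> ball 0 1" for w
    using mult_pos_pos[OF z Rem[OF that]] by (simp add: m_def del: times_divide_eq_right)
  have nz1: "1 - w \<noteq> 0" if "w \<in> ball 0 1" for w :: complex using that by auto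
  have "norm (deriv (F \<circ> m) 0) \<le> 4 * norm ((F \<circ> m) 0)"
  proof (rule koebe_quarter_unit)
    show "F \<circ> m holomorphic_on ball 0 1"
    proof (rule holomorphic_on_compose_gen[OF _ hol])
      show "m holomorphic_on ball 0 1"
        unfolding m_def using nz1 by (intro holomorphic_intros) blast
      show "m ` ball 0 1 \<subseteq> {z. Re z > 0}" using m by blast
    qed
    show "inj_on (F \<circ> m) (ball 0 1)"
    proof (rule comp_inj_on[OF _ inj_on_subset[OF inj]])
      show "inj_on m (ball 0 1)"
      proof (rule inj_onI)
        fix u w assume uw: "u \<in> ball 0 1" "w \<in> ball 0 1" "m u = m w"
        then have "(1 + u) / (1 - u) = (1 + w) / (1 - w)" using z by (simp add: m_def del: times_divide_eq_right)
        then have "(1 + u) * (1 - w) = (1 + w) * (1 - u)"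
          using nz1[OF uw(1)] nz1[OF uw(2)] by (simp add: frac_eq_eq)
        then show "u = w" by (simp add: algebra_simps)
      qed
      show "m ` ball 0 1 \<subseteq> {z. Re z > 0}" using m by blast
    qed
    show "(F \<circ> m) z \<noteq> 0" if "z \<in> ball 0 1" for z using nz[OF m[OF that]] by simp
  qed
  moreover have m0: "m 0 = z" by (simp add: m_def complex_eq_iff)
  moreover have "deriv (F \<circ> m) 0 = deriv F z * of_real (2 * Re z)"
  proof -
    have "(F has_field_derivative deriv F z) (at (m 0))"
      using holomorphic_derivI[OF hol open_halfspace_Re_gt, of z] z m0 by simp
    moreover have "(m has_field_derivative of_real (2 * Re z)) (at 0)"
      unfolding m_def by (auto intro!: derivative_eq_intros)
    ultimately have "(F \<circ> m has_field_derivative deriv F z * of_real (2 * Re z)) (at 0)"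
      by (rule DERIV_chain)
    then show ?thesis by (rule DERIV_imp_deriv)
  qed
  ultimately show ?thesis using z by (simp add: norm_mult mult.commute)
qed

text \<open>
  Let \<open>k\<close> be the difference quotient of \<open>F\<close> at \<open>a\<close>. The function \<open>F - F a\<close> has no zero in the disc about
  \<open>z\<close> with \<open>a\<close> on its boundary, so the quarter theorem bounds \<open>\<bar>F' z\<bar>\<close> by \<open>4 \<bar>k z\<bar>\<close>. Since
  \<open>F' = k + (z - a) k'\<close>, this bounds \<open>(z - a) k' / k\<close>, and the maximum principle carries the bound for
  \<open>k' / k\<close> to the centre, where \<open>2 k' a = F'' a\<close>. Any constant would do in place of \<open>40\<close>.
\<close>
lemma univalent_pre_schwarzian_bound:
  assumes hol: "F holomorphic_on ball a r" and inj: "inj_on F (ball a r)" and r: "r > 0"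
  shows "r * norm (deriv (deriv F) a) \<le> 40 * norm (deriv F a)"
proof -
  define k where "k z = (if z = a then deriv F a else (F z - F a) / (z - a))" for z
  have F'a: "deriv F a \<noteq> 0"
    using holomorphic_injective_imp_regular[OF hol _ inj] r by simp
  have holk: "k holomorphic_on ball a r"
    unfolding k_def using pole_lemma[OF hol, of a] r by simp
  have k_nz: "k z \<noteq> 0" if "z \<in> ball a r" for z
    using F'a that r inj_onD[OF inj, of z a] by (auto simp: k_def)
  have Fk: "F z = F a + (z - a) * k z" for z by (simp add: k_def)
  have F': "deriv F z = k z + (z - a) * deriv k z" if "z \<in> ball a r" for z
  proof -
    have "((\<lambda>z. F a + (z - a) * k z) has_field_derivative k z + (z - a) * deriv k z) (at z)"
      using holomorphic_derivI[OF holk open_ball that] 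
      by (auto intro!: derivative_eq_intros)
    then have "(F has_field_derivative k z + (z - a) * deriv k z) (at z)"
      by (rule has_field_derivative_transform_within_open[of _ _ _ UNIV]) (use Fk[symmetric] in auto)
    then show ?thesis by (rule DERIV_imp_deriv)
  qed
  have holk': "deriv k holomorphic_on ball a r" by (rule holomorphic_deriv[OF holk open_ball])
  have F'': "deriv (deriv F) a = 2 * deriv k a"
  proof -
    have a: "a \<in> ball a r" using r by simp
    have "((\<lambda>z. k z + (z - a) * deriv k z) has_field_derivative 2 * deriv k a) (at a)"
      using holomorphic_derivI[OF holk open_ball a] holomorphic_derivI[OF holk' open_ball a]
      by (auto intro!: derivative_eq_intros)
    then have "(deriv F has_field_derivative 2 * deriv k a) (at a)"
      by (rule has_field_derivative_transform_within_open[of _ _ _ "ball a r"]) (use F'[symmetric] r in auto)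
    then show ?thesis by (rule DERIV_imp_deriv)
  qed
  have bound: "norm (z - a) * norm (deriv k z) \<le> 5 * norm (k z)" if z: "z \<in> ball a (r / 2)" "z \<noteq> a" for z
  proof -
    let ?\<rho> = "norm (z - a)"
    have sub: "ball z ?\<rho> \<subseteq> ball a r"
    proof
      fix w assume "w \<in> ball z ?\<rho>"
      then have "dist a w < 2 * ?\<rho>" using dist_triangle[of a w z] by (simp add: dist_norm norm_minus_commute)
      then show "w \<in> ball a r" using z by (simp add: dist_norm norm_minus_commute)
    qed
    have "?\<rho> * norm (deriv (\<lambda>w. F w - F a) z) \<le> 4 * norm (F z - F a)"
    proof (rule koebe_quarter_ball)
      show "(\<lambda>w. F w - F a) holomorphic_on ball z ?\<rho>"
        by (intro holomorphic_intros holomorphic_on_subset[OF hol sub])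
      show "inj_on (\<lambda>w. F w - F a) (ball z ?\<rho>)"
        using inj_on_subset[OF inj sub] by (auto simp: inj_on_def)
      show "F w - F a \<noteq> 0" if "w \<in> ball z ?\<rho>" for w
      proof
        assume "F w - F a = 0"
        then have "w = a" using inj_onD[OF inj, of w a] that sub r by auto
        then show False using that by (simp add: dist_norm)
      qed
    qed (use z in simp)
    moreover have "deriv (\<lambda>w. F w - F a) z = deriv F z"
    proof -
      have "z \<in> ball a r" using z r by auto
      then have "((\<lambda>w. F w - F a) has_field_derivative deriv F z - 0) (at z)"
        using holomorphic_derivI[OF hol open_ball] by (intro derivative_intros) auto
      then show ?thesis by (simp add: DERIV_imp_deriv)
    qed
    moreover have "norm (F z - F a) = ?\<rho> * norm (k z)" using Fk[of z] by (simp add: norm_mult)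
    ultimately have "?\<rho> * norm (deriv F z) \<le> ?\<rho> * (4 * norm (k z))" by simp
    then have "norm (deriv F z) \<le> 4 * norm (k z)" using z by simp
    moreover have "deriv F z = k z + (z - a) * deriv k z" using F' z r by auto
    ultimately have "norm (k z + (z - a) * deriv k z) \<le> 4 * norm (k z)" by simp
    then have "norm ((z - a) * deriv k z) \<le> 5 * norm (k z)"
      using norm_triangle_ineq4[of "k z + (z - a) * deriv k z" "k z"] by simp
    then show ?thesis by (simp add: norm_mult)
  qed
  define h where "h z = deriv k z / k z" for z
  have "norm (h a) \<le> 20 / r"
  proof (rule maximum_modulus_frontier[where S = "ball a (r/4)" and f = h and \<xi> = a])
    have sub: "ball a (r/4) \<subseteq> ball a r" "cball a (r/4) \<subseteq> ball a r" using r by auto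
    have holh: "h holomorphic_on ball a r"
      unfolding h_def using k_nz by (intro holomorphic_intros holk holk') auto
    show "h holomorphic_on interior (ball a (r/4))"
      using holomorphic_on_subset[OF holh sub(1)] by simp
    show "continuous_on (closure (ball a (r/4))) h"
      using r continuous_on_subset[OF holomorphic_on_imp_continuous_on[OF holh] sub(2)] by simp
    show "norm (h z) \<le> 20 / r" if "z \<in> frontier (ball a (r/4))" for z
    proof -
      have d: "norm (z - a) = r/4" using that r by (simp add: frontier_ball dist_norm norm_minus_commute)
      then have "z \<in> ball a (r/2)" "z \<noteq> a" using r by (auto simp: dist_norm norm_minus_commute)
      from bound[OF this] k_nz[of z] d r \<open>z \<in> ball a (r/2)\<close> show ?thesis
        by (auto simp: h_def norm_divide field_simps)
    qed
  qed (use r in auto)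
  then have "r * norm (deriv k a) \<le> 20 * norm (k a)"
    using k_nz[of a] r by (simp add: h_def norm_divide field_simps)
  moreover have "k a = deriv F a" by (simp add: k_def)
  ultimately show ?thesis by (simp add: F'' norm_mult)
qed

section \<open>Bloch functions on the half-plane\<close>

lemma ln_one_plus_upper_bound_quadratic:
  fixes u :: real assumes "\<bar>u\<bar> \<le> 1 / 2"
  shows "ln (1 + u) \<le> u - u\<^sup>2 / 8"
proof -
  have "ln (1 + u) = 2 * ln (sqrt (1 + u))" using assms by (simp add: ln_sqrt)
  also have "\<dots> \<le> 2 * (sqrt (1 + u) - 1)"
    using ln_le_minus_one[of "sqrt (1 + u)"] assms abs_ge_minus_self[of u] by (simp del: abs_ge_minus_self)
  also have "sqrt (1 + u) \<le> 1 + u / 2 - u\<^sup>2 / 16"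
  proof (rule real_le_lsqrt)
    have u: "-1/2 \<le> u" "u \<le> 1/2" using assms by auto
    have u2: "u\<^sup>2 \<le> 1/4" using abs_le_square_iff[of u "1/2"] assms by (simp add: power2_eq_square)
    show "0 \<le> 1 + u / 2 - u\<^sup>2 / 16" using u u2 by linarith
    have "(1 + u / 2 - u\<^sup>2 / 16)\<^sup>2 = 1 + u + u\<^sup>2 * (1/8 - u / 16 + u\<^sup>2 / 256)"
      by (simp add: power2_eq_square field_simps)
    moreover have "0 \<le> u\<^sup>2 * (1/8 - u / 16 + u\<^sup>2 / 256)"
      using u by (intro mult_nonneg_nonneg) (auto intro: add_nonneg_nonneg)
    ultimately show "1 + u \<le> (1 + u / 2 - u\<^sup>2 / 16)\<^sup>2" by linarith
  qed
  finally show ?thesis by (simp add: algebra_simps)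
qed

text \<open>The maximum principle for \<open>exp (- h)\<close>.\<close>
lemma exists_on_circle_Re_nonpos:
  fixes h :: "complex \<Rightarrow> complex"
  assumes hol: "h holomorphic_on ball 0 1" and cont: "continuous_on (cball 0 1) h" and h0: "h 0 = 0"
  shows "\<exists>w. norm w = 1 \<and> Re (h w) \<le> 0"
proof (rule ccontr)
  assume *: "\<not> ?thesis"
  then have pos: "Re (h w) > 0" if "norm w = 1" for w using that not_le by blast
  have "continuous_on (sphere 0 1) (\<lambda>w. Re (h w))"
    by (intro continuous_intros continuous_on_subset[OF cont]) auto
  from continuous_attains_inf[OF compact_sphere _ this]
  obtain w0 where w0: "norm w0 = 1" "\<And>w. norm w = 1 \<Longrightarrow> Re (h w0) \<le> Re (h w)"
    by auto
  have "norm (exp (- h 0)) \<le> exp (- Re (h w0))"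
  proof (rule maximum_modulus_frontier[where S = "ball 0 1" and f = "\<lambda>z. exp (- h z)"])
    show "(\<lambda>z. exp (- h z)) holomorphic_on interior (ball 0 1)"
      using hol by (auto intro!: holomorphic_intros)
    show "continuous_on (closure (ball 0 1)) (\<lambda>z. exp (- h z))"
      using cont by (auto intro!: continuous_intros)
    show "norm (exp (- h z)) \<le> exp (- Re (h w0))" if "z \<in> frontier (ball 0 1)" for z
      using w0(2)[of z] that by (simp add: norm_exp_eq_Re frontier_ball)
  qed auto
  then show False using pos[OF w0(1)] h0 by simp
qed

text \<open>
  A holomorphic \<open>G\<close> with \<open>Re z * \<bar>G' z\<bar> \<le> B\<close> is a Bloch function of the half-plane; it is Lipschitz
  on each smaller half-plane.
\<close>
lemma bloch_half_plane_lipschitz: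
  assumes hol: "G holomorphic_on {z. Re z > 0}" and B: "\<And>z. Re z > 0 \<Longrightarrow> Re z * norm (deriv G z) \<le> B"
    and x: "x > 0" "Re a \<ge> x" "Re b \<ge> x"
  shows "norm (G a - G b) \<le> B / x * norm (a - b)"
proof (rule field_differentiable_bound[where S = "{z. Re z \<ge> x}" and f' = "deriv G"])
  show "convex {z. Re z \<ge> x}" by (rule convex_halfspace_Re_ge)
  fix z assume "z \<in> {z. Re z \<ge> x}"
  then have z: "Re z > 0" "Re z \<ge> x" using x by auto
  show "(G has_field_derivative deriv G z) (at z within {z. Re z \<ge> x})"
    using holomorphic_derivI[OF hol open_halfspace_Re_gt, of z] z by (simp add: has_field_derivative_at_within)
  have "x * norm (deriv G z) \<le> Re z * norm (deriv G z)" using z by (intro mult_right_mono) auto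
  then have "x * norm (deriv G z) \<le> B" using B[OF z(1)] by linarith
  then show "norm (deriv G z) \<le> B / x" using x by (simp add: field_simps)
qed (use x in auto)

text \<open>
  The descent is greedy. On the circle about \<open>c\<close> of radius \<open>Re c / 2\<close>, the squares \<open>\<bar>G - a\<bar>\<^sup>2\<close> exceed
  their value at \<open>c\<close> by the real part of a holomorphic function vanishing at \<open>c\<close> plus at most \<open>B\<^sup>2\<close> each.
  For the concave function \<open>ln (Re z)\<close> the increase is at most such a real part minus \<open>1/64\<close>. With the
  weight \<open>192 B\<^sup>2 = 64 * 3 B\<^sup>2\<close> the gain exceeds the total loss \<open>2 B\<^sup>2\<close> by \<open>B\<^sup>2\<close>, and at some point of the
  circle the sum of the real parts is not positive.
\<close>
lemma bloch_descent_step: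
  fixes G1 G2 :: "complex \<Rightarrow> complex" and a1 a2 :: complex
  assumes hol: "G1 holomorphic_on {z. Re z > 0}" "G2 holomorphic_on {z. Re z > 0}"
    and B1: "\<And>z. Re z > 0 \<Longrightarrow> Re z * norm (deriv G1 z) \<le> B"
    and B2: "\<And>z. Re z > 0 \<Longrightarrow> Re z * norm (deriv G2 z) \<le> B"
    and W: "\<And>z. W z = (norm (G1 z - a1))\<^sup>2 + (norm (G2 z - a2))\<^sup>2 + 192 * B\<^sup>2 * ln (Re z)"
    and c: "Re c > 0"
  shows "\<exists>z. Re z \<ge> Re c / 2 \<and> W z \<le> W c - B\<^sup>2"
proof -
  define x where "x = Re c"
  have x: "x > 0" using c by (simp add: x_def)
  define m where "m w = c + of_real (x / 2) * w" for w :: complex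
  have Rem: "Re (m w) = x * (1 + Re w / 2)" for w by (simp add: m_def x_def algebra_simps)
  have Rew: "\<bar>Re w\<bar> \<le> 1" if "norm w \<le> 1" for w using abs_Re_le_cmod[of w] that by linarith
  have mH: "Re (m w) \<ge> x / 2" if "norm w \<le> 1" for w
  proof -
    have "x * (1 / 2) \<le> x * (1 + Re w / 2)" using x Rew[OF that] by (intro mult_left_mono) auto
    then show ?thesis by (simp add: Rem)
  qed
  define u1 where "u1 = G1 c - a1"
  define u2 where "u2 = G2 c - a2"
  define h where "h w = 2 * cnj u1 * (G1 (m w) - G1 c) + 2 * cnj u2 * (G2 (m w) - G2 c) 
     + of_real (192 * B\<^sup>2) * (w / 2 - w\<^sup>2 / 64)" for w
  have mim: "m ` cball 0 1 \<subseteq> {z. Re z > 0}"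
    using mH x by force
  have holm: "m holomorphic_on S" for S unfolding m_def by (intro holomorphic_intros)
  have comp: "(\<lambda>w. G (m w)) holomorphic_on ball 0 1 \<and> continuous_on (cball 0 1) (\<lambda>w. G (m w))" 
    if G: "G holomorphic_on {z. Re z > 0}" for G
  proof
    show "(\<lambda>w. G (m w)) holomorphic_on ball 0 1"
      using holomorphic_on_compose_gen[OF holm G, of "ball 0 1"] mim by (force simp: o_def)
    show "continuous_on (cball 0 1) (\<lambda>w. G (m w))"
      using continuous_on_compose2[OF holomorphic_on_imp_continuous_on[OF G]
         holomorphic_on_imp_continuous_on[OF holm] mim] .
  qed
  have "h holomorphic_on ball 0 1"
    unfolding h_def using comp[OF hol(1)] comp[OF hol(2)] by (intro holomorphic_intros) auto
  moreover have "continuous_on (cball 0 1) h"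
    unfolding h_def using comp[OF hol(1)] comp[OF hol(2)] by (intro continuous_intros) auto
  moreover have "h 0 = 0" by (simp add: h_def m_def)
  ultimately obtain w where w: "norm w = 1" "Re (h w) \<le> 0"
    using exists_on_circle_Re_nonpos by blast
  define z where "z = m w"
  have inc: "norm (G z - G c) \<le> B" 
    if G: "G holomorphic_on {z. Re z > 0}" "\<And>z. Re z > 0 \<Longrightarrow> Re z * norm (deriv G z) \<le> B" for G
  proof -
    have "norm (G z - G c) \<le> B / (x / 2) * norm (z - c)"
      by (rule bloch_half_plane_lipschitz[OF G]) (use x mH[of w] w in \<open>auto simp: z_def x_def\<close>)
    also have "norm (z - c) = x / 2" using x w by (simp add: z_def m_def norm_mult)
    finally show ?thesis using x by simp
  qed
  have sq: "(norm (G z - a))\<^sup>2 \<le> (norm (G c - a))\<^sup>2 + Re (2 * cnj (G c - a) * (G z - G c)) + B\<^sup>2"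
    if "norm (G z - G c) \<le> B" for G a
  proof -
    have "(norm (p + q))\<^sup>2 = (norm p)\<^sup>2 + Re (2 * cnj p * q) + (norm q)\<^sup>2" for p q
      unfolding cmod_power2 by (simp add: power2_eq_square algebra_simps)
    from this[of "G c - a" "G z - G c"] power_mono[OF that norm_ge_zero, of 2] show ?thesis by simp
  qed
  have s1: "(norm (G1 z - a1))\<^sup>2 \<le> (norm (G1 c - a1))\<^sup>2 + Re (2 * cnj u1 * (G1 z - G1 c)) + B\<^sup>2"
    unfolding u1_def by (rule sq[OF inc[OF hol(1) B1]])
  have s2: "(norm (G2 z - a2))\<^sup>2 \<le> (norm (G2 c - a2))\<^sup>2 + Re (2 * cnj u2 * (G2 z - G2 c)) + B\<^sup>2"
    unfolding u2_def by (rule sq[OF inc[OF hol(2) B2]])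
  \<comment> \<open>\<open>(Re w)\<^sup>2 = (1 + Re (w\<^sup>2)) / 2\<close> on the unit circle turns the quadratic bound for \<open>ln\<close> into a real part minus \<open>1 / 64\<close>\<close>
  have lnz: "ln (Re z) \<le> ln x + Re (w / 2 - w\<^sup>2 / 64) - 1 / 64"
  proof -
    have "(Re w)\<^sup>2 + (Im w)\<^sup>2 = 1" using w(1) by (simp add: cmod_def)
    then have "Re (w\<^sup>2) = 2 * (Re w)\<^sup>2 - 1" by (simp add: power2_eq_square)
    moreover have "ln (1 + Re w / 2) \<le> Re w / 2 - (Re w / 2)\<^sup>2 / 8"
      using Rew[of w] w by (intro ln_one_plus_upper_bound_quadratic) auto
    moreover have "ln (Re z) = ln x + ln (1 + Re w / 2)"
      unfolding z_def Rem using x Rew[of w] w by (intro ln_mult_pos) (auto simp: abs_le_iff)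
    moreover have "(Re w / 2)\<^sup>2 / 8 = (Re w)\<^sup>2 / 32" by (simp add: power_divide)
    moreover have "Re (w / 2 - w\<^sup>2 / 64) = Re w / 2 - Re (w\<^sup>2) / 64" by simp
    ultimately show ?thesis by linarith
  qed
  have "192 * B\<^sup>2 * ln (Re z) \<le> 192 * B\<^sup>2 * (ln x + Re (w / 2 - w\<^sup>2 / 64) - 1 / 64)"
    by (rule mult_left_mono[OF lnz]) simp
  also have "\<dots> = 192 * B\<^sup>2 * ln x + Re (of_real (192 * B\<^sup>2) * (w / 2 - w\<^sup>2 / 64)) - 3 * B\<^sup>2"
    by (simp add: algebra_simps)
  finally have s3: "192 * B\<^sup>2 * ln (Re z) \<le> 192 * B\<^sup>2 * ln x + Re (of_real (192 * B\<^sup>2) * (w / 2 - w\<^sup>2 / 64)) - 3 * B\<^sup>2" .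
  have "Re (h w) = Re (2 * cnj u1 * (G1 z - G1 c)) + Re (2 * cnj u2 * (G2 z - G2 c)) 
      + Re (of_real (192 * B\<^sup>2) * (w / 2 - w\<^sup>2 / 64))"
    unfolding h_def z_def by (simp only: plus_complex.sel)
  then have "W z \<le> W c - B\<^sup>2" unfolding W using s1 s2 s3 w(2) unfolding x_def by linarith
  moreover have "Re z \<ge> Re c / 2" using mH[of w] w by (simp add: z_def x_def)
  ultimately show ?thesis by blast
qed

text \<open>
  Along a chain of such steps the potential \<open>W\<close> decreases without bound, so \<open>Re z\<close> has to fall to \<open>x\<close>;
  no step more than halves it, hence it stops above \<open>x / 2\<close>. That \<open>W\<close> has not increased meanwhile bounds
  the change of \<open>G1\<close> and \<open>G2\<close> by the square root of the logarithm of the ratio of the two distances,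
  where the Lipschitz bound alone would give the logarithm itself.
\<close>
lemma bloch_descent:
  fixes G1 G2 :: "complex \<Rightarrow> complex"
  assumes hol: "G1 holomorphic_on {z. Re z > 0}" "G2 holomorphic_on {z. Re z > 0}"
    and B1: "\<And>z. Re z > 0 \<Longrightarrow> Re z * norm (deriv G1 z) \<le> B"
    and B2: "\<And>z. Re z > 0 \<Longrightarrow> Re z * norm (deriv G2 z) \<le> B"
    and B: "B > 0" and x: "0 < x" "x \<le> Re c"
  shows "\<exists>z. x / 2 < Re z \<and> Re z \<le> x \<and> (norm (G1 z - G1 c))\<^sup>2 \<le> 192 * B\<^sup>2 * ln (2 * Re c / x)
     \<and> (norm (G2 z - G2 c))\<^sup>2 \<le> 192 * B\<^sup>2 * ln (2 * Re c / x)"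
proof -
  define W where "W z = (norm (G1 z - G1 c))\<^sup>2 + (norm (G2 z - G2 c))\<^sup>2 + 192 * B\<^sup>2 * ln (Re z)" for z
  note step = bloch_descent_step[OF hol B1 B2 W_def]
  have "\<exists>z. x / 2 < Re z \<and> Re z \<le> x \<and> W z \<le> W c"
  proof (rule ccontr)
    assume no: "\<not> ?thesis"
    have "\<exists>z. Re z > x \<and> W z \<le> W c - real n * B\<^sup>2" for n
    proof (induction n)
      case 0
      have "Re c \<noteq> x" using no x by force
      then show ?case using x by (intro exI[of _ c]) auto
    next
      case (Suc n)
      then obtain z where z: "Re z > x" "W z \<le> W c - real n * B\<^sup>2" by blast
      obtain z' where z': "Re z' \<ge> Re z / 2" "W z' \<le> W z - B\<^sup>2" using step[of z] z x by auto
      have "W z' \<le> W c - real (Suc n) * B\<^sup>2" using z z' by (simp add: algebra_simps)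
      moreover have "real (Suc n) * B\<^sup>2 \<ge> 0" by simp
      ultimately have "W z' \<le> W c" by linarith
      moreover have "Re z' > x / 2" using z z' by linarith
      ultimately have "Re z' > x" using no not_le by blast
      then show ?case using \<open>W z' \<le> W c - real (Suc n) * B\<^sup>2\<close> by blast
    qed note * = this
    obtain n :: nat where n: "(W c - 192 * B\<^sup>2 * ln x) / B\<^sup>2 < real n" using reals_Archimedean2 by blast
    obtain z where z: "Re z > x" "W z \<le> W c - real n * B\<^sup>2" using * by blast
    have "192 * B\<^sup>2 * ln x \<le> 192 * B\<^sup>2 * ln (Re z)" using z x by (intro mult_left_mono) auto
    also have "\<dots> \<le> W z" by (simp add: W_def)
    finally have "real n * B\<^sup>2 \<le> W c - 192 * B\<^sup>2 * ln x" using z by linarith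
    then show False using n B by (simp add: field_simps)
  qed
  then obtain z where z: "x / 2 < Re z" "Re z \<le> x" "W z \<le> W c" by blast
  have "(norm (G1 z - G1 c))\<^sup>2 + (norm (G2 z - G2 c))\<^sup>2 \<le> 192 * B\<^sup>2 * (ln (Re c) - ln (Re z))"
    using z(3) by (simp add: W_def algebra_simps)
  also have "\<dots> \<le> 192 * B\<^sup>2 * ln (2 * Re c / x)"
  proof (rule mult_left_mono)
    have "ln (x / 2) \<le> ln (Re z)" using z x by simp
    then show "ln (Re c) - ln (Re z) \<le> ln (2 * Re c / x)" using x by (simp add: ln_div ln_mult)
  qed simp
  finally show ?thesis
    using z zero_le_power2[of "norm (G1 z - G1 c)"] zero_le_power2[of "norm (G2 z - G2 c)"]
    by (intro exI[of _ z] conjI) linarith+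
qed

lemma univalent_half_plane_logarithms:
  assumes hol: "\<phi> holomorphic_on {z. Re z > 0}" and inj: "inj_on \<phi> {z. Re z > 0}"
    and nz: "\<And>z. Re z > 0 \<Longrightarrow> \<phi> z \<noteq> 0"
  obtains G1 G2 where "G1 holomorphic_on {z. Re z > 0}" "G2 holomorphic_on {z. Re z > 0}"
    "\<And>z. Re z > 0 \<Longrightarrow> \<phi> z = exp (G1 z)" "\<And>z. Re z > 0 \<Longrightarrow> deriv \<phi> z = exp (G2 z)"
    "\<And>z. Re z > 0 \<Longrightarrow> Re z * norm (deriv G1 z) \<le> 2"
    "\<And>z. Re z > 0 \<Longrightarrow> Re z * norm (deriv G2 z) \<le> 40"
proof -
  let ?H = "{z. Re z > 0}"
  have H: "open ?H" "contractible ?H"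
    by (auto simp: open_halfspace_Re_gt intro!: convex_imp_contractible convex_halfspace_Re_gt)
  have hol': "deriv \<phi> holomorphic_on ?H" using hol H(1) by (rule holomorphic_deriv)
  have nz': "deriv \<phi> z \<noteq> 0" if "z \<in> ?H" for z
    using holomorphic_injective_imp_regular[OF hol H(1) inj that] .
  obtain G1 where G1: "G1 holomorphic_on ?H" "\<And>z. z \<in> ?H \<Longrightarrow> \<phi> z = exp (G1 z)"
    using contractible_imp_holomorphic_log[OF hol H(2)] nz by blast
  obtain G2 where G2: "G2 holomorphic_on ?H" "\<And>z. z \<in> ?H \<Longrightarrow> deriv \<phi> z = exp (G2 z)"
    using contractible_imp_holomorphic_log[OF hol' H(2) nz'] by blast
  have der_log: "deriv F z = F z * deriv G z"
    if G: "G holomorphic_on ?H" "\<And>z. z \<in> ?H \<Longrightarrow> F z = exp (G z)" and z: "z \<in> ?H" for F G z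
  proof -
    have "((\<lambda>z. exp (G z)) has_field_derivative exp (G z) * deriv G z) (at z)"
      using holomorphic_derivI[OF G(1) H(1) z] by (auto intro!: derivative_eq_intros)
    then have "(F has_field_derivative exp (G z) * deriv G z) (at z)"
      by (rule has_field_derivative_transform_within_open[OF _ H(1) z]) (use G(2) in auto)
    then show ?thesis using G(2)[OF z] by (simp add: DERIV_imp_deriv)
  qed
  show ?thesis
  proof (rule that)
    show "G1 holomorphic_on ?H" "G2 holomorphic_on ?H" by (fact G1(1) G2(1))+
    fix z :: complex assume z: "Re z > 0"
    then have zH: "z \<in> ?H" by simp
    show "\<phi> z = exp (G1 z)" "deriv \<phi> z = exp (G2 z)" using G1(2)[OF zH] G2(2)[OF zH] .
    show "Re z * norm (deriv G1 z) \<le> 2"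
      using koebe_quarter_half_plane[OF hol inj nz z] der_log[OF G1 zH] nz[OF z]
      by (simp add: norm_mult field_simps)
    have sub: "ball z (Re z) \<subseteq> ?H"
    proof
      fix w assume "w \<in> ball z (Re z)"
      then show "w \<in> ?H" using abs_Re_le_cmod[of "z - w"] by (auto simp: dist_norm)
    qed
    show "Re z * norm (deriv G2 z) \<le> 40"
      using univalent_pre_schwarzian_bound[OF holomorphic_on_subset[OF hol sub] inj_on_subset[OF inj sub] z]
        der_log[OF G2 zH] nz'[OF zH]
      by (simp add: norm_mult field_simps)
  qed
qed

text \<open>Integrate the quarter theorem along the real axis.\<close>
lemma univalent_half_plane_quadratic_growth:
  assumes hol: "\<phi> holomorphic_on {z. Re z > 0}" and inj: "inj_on \<phi> {z. Re z > 0}"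
    and nz: "\<And>z. Re z > 0 \<Longrightarrow> \<phi> z \<noteq> 0" and s: "s \<ge> 1"
  shows "norm (\<phi> (of_real s)) \<le> norm (\<phi> 1) * s\<^sup>2"
proof -
  obtain G1 G2 where G: "G1 holomorphic_on {z. Re z > 0}" 
    "\<And>z. Re z > 0 \<Longrightarrow> \<phi> z = exp (G1 z)" 
    "\<And>z. Re z > 0 \<Longrightarrow> Re z * norm (deriv G1 z) \<le> 2"
    using univalent_half_plane_logarithms[OF hol inj nz] by metis
  define g where "g u = Re (G1 (of_real u)) - 2 * ln u" for u :: real
  have "g s \<le> g 1"
  proof (rule DERIV_nonpos_imp_nonincreasing[OF s])
    fix u :: real assume u: "1 \<le> u"
    have "(G1 has_field_derivative deriv G1 (of_real u)) (at (of_real u))"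
      using holomorphic_derivI[OF G(1) open_halfspace_Re_gt, of "of_real u"] u by simp
    then have "(G1 has_derivative (*) (deriv G1 (of_real u))) (at (of_real u))"
      by (simp add: has_field_derivative_def)
    moreover have "((of_real :: real \<Rightarrow> complex) has_derivative of_real) (at u)"
      by (rule bounded_linear_imp_has_derivative[OF bounded_linear_of_real])
    ultimately have "((\<lambda>u. G1 (of_real u)) has_derivative (\<lambda>h. deriv G1 (of_real u) * of_real h)) (at u)"
      using has_derivative_compose by fastforce
    then have "((\<lambda>u. Re (G1 (of_real u))) has_derivative (\<lambda>h. Re (deriv G1 (of_real u) * of_real h))) (at u)"
      by (rule bounded_linear.has_derivative[OF bounded_linear_Re])
    then have 1: "((\<lambda>u. Re (G1 (of_real u))) has_field_derivative Re (deriv G1 (of_real u))) (at u)"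
      by (simp add: has_field_derivative_def mult_commute_abs)
    have "(g has_field_derivative Re (deriv G1 (of_real u)) - 2 * (1 / u)) (at u)"
      unfolding g_def using u by (intro DERIV_diff[OF 1] DERIV_cmult DERIV_ln_divide) auto
    moreover have "u * norm (deriv G1 (of_real u)) \<le> 2" using G(3)[of "of_real u"] u by simp
    then have "norm (deriv G1 (of_real u)) \<le> 2 * (1 / u)" using u by (simp add: field_simps)
    then have "Re (deriv G1 (of_real u)) - 2 * (1 / u) \<le> 0" 
      using complex_Re_le_cmod[of "deriv G1 (of_real u)"] by linarith
    ultimately show "\<exists>y. (g has_field_derivative y) (at u) \<and> y \<le> 0" by blast
  qed
  then have "Re (G1 (of_real s)) \<le> Re (G1 1) + 2 * ln s" by (simp add: g_def)
  then have "exp (Re (G1 (of_real s))) \<le> exp (Re (G1 1) + 2 * ln s)" by simp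
  also have "\<dots> = exp (Re (G1 1)) * s\<^sup>2" using s by (simp add: exp_add exp_double)
  finally show ?thesis using G(2)[of 1] G(2)[of "of_real s"] s by (simp add: norm_exp_eq_Re)
qed

text \<open>
  The base point \<open>z0\<close> has real part \<open>s\<close> with \<open>C s\<^sup>2 = exp t\<close>: on the vertical line through \<open>s\<close> the modulus
  of \<open>\<phi>\<close> starts at most at \<open>exp t\<close> by quadratic growth and is unbounded, so it takes the value \<open>exp t\<close>.
  The descent from there ends at a point with real part about \<open>t' - L\<close>. A rectangle of
  width \<open>O(sqrt t')\<close> about that point has bounded hyperbolic size, so the estimates persist on it. The width is
  needed because moduli are prescribed only up to a factor \<open>exp (O(sqrt t))\<close>, and its height \<open>2\<pi>\<close>
  makes the exponential map it onto a full annulus.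
\<close>
lemma univalent_half_plane_tame_rectangle:
  fixes L :: real
  assumes hol: "\<phi> holomorphic_on {z. Re z > 0}" and inj: "inj_on \<phi> {z. Re z > 0}"
    and nz: "\<And>z. Re z > 0 \<Longrightarrow> \<phi> z \<noteq> 0"
    and unb: "\<And>s M. s > 0 \<Longrightarrow> \<exists>y. norm (\<phi> (Complex s y)) > M"
  shows "\<exists>K T. K \<ge> 0 \<and> T \<ge> 1 \<and> (\<forall>t t'. T \<le> t \<longrightarrow> t \<le> t' \<longrightarrow> t' \<le> 2 * t \<longrightarrow> 
    (\<exists>y. \<forall>z. \<bar>Re z + L - t'\<bar> \<le> K * sqrt t' \<and> \<bar>Im z - y\<bar> \<le> pi \<longrightarrow>
       Re z > 0 \<and> \<bar>ln (norm (\<phi> z)) - t\<bar> \<le> K * sqrt t \<and> ln (norm (deriv \<phi> z)) \<le> t / 2 + K * sqrt t))"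
proof -
  obtain G1 G2 where G: "G1 holomorphic_on {z. Re z > 0}" "G2 holomorphic_on {z. Re z > 0}"
    "\<And>z. Re z > 0 \<Longrightarrow> \<phi> z = exp (G1 z)" "\<And>z. Re z > 0 \<Longrightarrow> deriv \<phi> z = exp (G2 z)"
    and GB: "\<And>z. Re z > 0 \<Longrightarrow> Re z * norm (deriv G1 z) \<le> 2"
    "\<And>z. Re z > 0 \<Longrightarrow> Re z * norm (deriv G2 z) \<le> 40"
    using univalent_half_plane_logarithms[OF hol inj nz] by blast
  have GB1: "Re z * norm (deriv G1 z) \<le> 40" if "Re z > 0" for z using GB(1)[OF that] by linarith
  define C where "C = norm (\<phi> 1)"
  have C: "C > 0" using nz[of 1] by (simp add: C_def)
  define K where "K = 720 + \<bar>ln (2 * sqrt C)\<bar>"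
  have K: "K \<ge> 720" by (simp add: K_def)
  have "\<forall>\<^sub>F t in at_top. t \<ge> (1::real)" "\<forall>\<^sub>F t in at_top. ln C \<le> t" "\<forall>\<^sub>F t in at_top. - ln C \<le> t"
    "\<forall>\<^sub>F t in at_top. 4 + \<bar>L\<bar> \<le> t" by (rule eventually_ge_at_top)+
  moreover have "\<forall>\<^sub>F t in at_top. 2 * t + \<bar>L\<bar> \<le> exp (t / 2) / sqrt C" using C by real_asymp
  moreover have "\<forall>\<^sub>F t in at_top. K * sqrt (2 * t) \<le> (t - \<bar>L\<bar>) / 2" by real_asymp
  ultimately have "\<forall>\<^sub>F t in at_top. t \<ge> 1 \<and> ln C \<le> t \<and> - ln C \<le> t \<and> 4 + \<bar>L\<bar> \<le> t \<and>
     2 * t + \<bar>L\<bar> \<le> exp (t / 2) / sqrt C \<and> K * sqrt (2 * t) \<le> (t - \<bar>L\<bar>) / 2"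
    by eventually_elim blast
  then obtain T where T: "\<And>t. t \<ge> T \<Longrightarrow> t \<ge> 1 \<and> ln C \<le> t \<and> - ln C \<le> t \<and> 4 + \<bar>L\<bar> \<le> t \<and>
     2 * t + \<bar>L\<bar> \<le> exp (t / 2) / sqrt C \<and> K * sqrt (2 * t) \<le> (t - \<bar>L\<bar>) / 2"
    unfolding eventually_at_top_linorder by blast
  have main: "\<exists>y. \<forall>z. \<bar>Re z + L - t'\<bar> \<le> K * sqrt t' \<and> \<bar>Im z - y\<bar> \<le> pi \<longrightarrow>
       Re z > 0 \<and> \<bar>ln (norm (\<phi> z)) - t\<bar> \<le> K * sqrt t \<and> ln (norm (deriv \<phi> z)) \<le> t / 2 + K * sqrt t"
    if t: "T \<le> t" "t \<le> t'" "t' \<le> 2 * t" for t t'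
  proof -
    note Tt = T[OF t(1)]
    define s where "s = exp (t / 2) / sqrt C"
    have lns: "ln s = t / 2 - ln C / 2" using C by (simp add: s_def ln_div ln_sqrt)
    have s0: "s > 0" using C by (simp add: s_def)
    have s1: "s \<ge> 1" 
    proof -
      have "ln 1 \<le> ln s" using Tt lns by simp
      then show ?thesis using s0 by (subst (asm) ln_le_cancel_iff) auto
    qed
    have Cs: "C * s\<^sup>2 = exp t" using C by (simp add: s_def power_divide flip: exp_double)
    have low: "norm (\<phi> (Complex s 0)) \<le> exp t"
      using univalent_half_plane_quadratic_growth[OF hol inj nz s1] Cs by (simp add: C_def complex_of_real_def)
    obtain y1 where y1: "norm (\<phi> (Complex s y1)) > exp t" using unb s0 by blast
    have cont: "continuous_on UNIV (\<lambda>y. norm (\<phi> (Complex s y)))"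
      unfolding Complex_eq
      by (intro continuous_on_norm continuous_on_compose2[OF holomorphic_on_imp_continuous_on[OF hol]] 
           continuous_intros) (use s0 in auto)
    have "\<exists>Y. norm (\<phi> (Complex s Y)) = exp t"
    proof -
      have "connected ((\<lambda>y. norm (\<phi> (Complex s y))) ` UNIV)"
        using cont by (rule connected_continuous_image) (rule connected_UNIV)
      then have "exp t \<in> (\<lambda>y. norm (\<phi> (Complex s y))) ` UNIV"
        by (rule connectedD_interval[of _ "norm (\<phi> (Complex s 0))" "norm (\<phi> (Complex s y1))"])
           (use low y1 in \<open>simp_all add: less_imp_le\<close>)
      then obtain Y where "exp t = norm (\<phi> (Complex s Y))" by blast
      then show ?thesis by (intro exI[of _ Y]) (simp only:)
    qed
    then obtain Y where Y: "norm (\<phi> (Complex s Y)) = exp t" by blast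
    define z0 where "z0 = Complex s Y"
    have z0: "Re z0 = s" "norm (\<phi> z0) = exp t" "Re z0 > 0" using Y s0 by (auto simp: z0_def)
    have G1z0: "Re (G1 z0) = t" using G(3)[OF z0(3)] z0(2) by (simp add: norm_exp_eq_Re)
    have G2z0: "Re (G2 z0) \<le> t / 2 + ln (2 * sqrt C)"
    proof -
      have "s * norm (deriv \<phi> z0) \<le> 2 * exp t"
        using koebe_quarter_half_plane[OF hol inj nz z0(3)] z0 by simp
      then have "norm (deriv \<phi> z0) \<le> 2 * exp t / s" using s0 by (simp add: field_simps)
      also have "2 * exp t / s = exp (t / 2) * (2 * sqrt C)"
        using C by (simp add: s_def field_simps flip: exp_double exp_add)
      finally have "exp (Re (G2 z0)) \<le> exp (t / 2) * (2 * sqrt C)"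
        using G(4)[OF z0(3)] by (simp add: norm_exp_eq_Re)
      also have "\<dots> = exp (t / 2 + ln (2 * sqrt C))" using C by (simp add: exp_add)
      finally show ?thesis by simp
    qed
    define x where "x = t' - L"
    have x: "4 \<le> x" "x \<le> s" "K * sqrt t' \<le> x / 2"
    proof -
      have "4 + \<bar>L\<bar> \<le> t" "2 * t + \<bar>L\<bar> \<le> s" using Tt unfolding s_def by blast+
      then show "4 \<le> x" "x \<le> s" using t unfolding x_def by linarith+
      have "K * sqrt t' \<le> K * sqrt (2 * t)" using t K by (intro mult_left_mono) auto
      also have "\<dots> \<le> (t - \<bar>L\<bar>) / 2" using Tt by blast
      also have "\<dots> \<le> x / 2" using t by (simp add: x_def)
      finally show "K * sqrt t' \<le> x / 2" .
    qed
    obtain z1 where z1: "x / 2 < Re z1" "Re z1 \<le> x" 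
      "(norm (G1 z1 - G1 z0))\<^sup>2 \<le> 192 * 40\<^sup>2 * ln (2 * Re z0 / x)"
      "(norm (G2 z1 - G2 z0))\<^sup>2 \<le> 192 * 40\<^sup>2 * ln (2 * Re z0 / x)"
      using bloch_descent[OF G(1,2) GB1 GB(2), of x z0] x z0(1) by auto
    have "ln (2 * Re z0 / x) \<le> t"
    proof -
      have "2 * Re z0 / x \<le> s" using x s0 z0(1) by (simp add: field_simps)
      then have "ln (2 * Re z0 / x) \<le> ln s" using x s0 z0(1) by (subst ln_le_cancel_iff) auto
      also have "\<dots> \<le> t" using lns Tt by linarith
      finally show ?thesis .
    qed
    then have sq: "192 * 40\<^sup>2 * ln (2 * Re z0 / x) \<le> (560 * sqrt t)\<^sup>2"
      using Tt by (simp add: power_mult_distrib)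
    have d1: "norm (G1 z1 - G1 z0) \<le> 560 * sqrt t"
      using z1(3) sq Tt by (intro power2_le_imp_le[of "norm (G1 z1 - G1 z0)"]) auto
    have d2: "norm (G2 z1 - G2 z0) \<le> 560 * sqrt t"
      using z1(4) sq Tt by (intro power2_le_imp_le[of "norm (G2 z1 - G2 z0)"]) auto
    have t1: "1 \<le> sqrt t" using Tt by simp
    show ?thesis
    proof (intro exI[of _ "Im z1"] allI impI)
      fix z assume z: "\<bar>Re z + L - t'\<bar> \<le> K * sqrt t' \<and> \<bar>Im z - Im z1\<bar> \<le> pi"
      have Rez: "\<bar>Re z - x\<bar> \<le> x / 2" using z x(3) unfolding x_def by linarith
      then have "Re z \<ge> x / 2" by linarith
      have "norm (z - z1) \<le> \<bar>Re (z - z1)\<bar> + \<bar>Im (z - z1)\<bar>" by (rule cmod_le)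
      also have "\<dots> \<le> x + pi" using Rez z z1(1,2) unfolding minus_complex.sel by linarith
      also have "\<dots> \<le> 2 * x" using x pi_less_4 by simp
      finally have dist: "norm (z - z1) \<le> 2 * x" .
      have lip: "norm (G z - G z1) \<le> 160" 
        if "G holomorphic_on {z. Re z > 0}" "\<And>z. Re z > 0 \<Longrightarrow> Re z * norm (deriv G z) \<le> 40" for G
      proof -
        have "norm (G z - G z1) \<le> 40 / (x / 2) * norm (z - z1)"
          by (rule bloch_half_plane_lipschitz[OF that]) (use x z1 \<open>Re z \<ge> x / 2\<close> in auto)
        also have "\<dots> \<le> 40 / (x / 2) * (2 * x)" using dist x by (intro mult_left_mono) auto
        finally show ?thesis using x by simp
      qed
      have z_pos: "Re z > 0" using \<open>Re z \<ge> x / 2\<close> x by linarith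
      have tot: "\<bar>Re (G z) - Re (G z0)\<bar> \<le> 720 * sqrt t" 
        if "norm (G z - G z1) \<le> 160" "norm (G z1 - G z0) \<le> 560 * sqrt t" for G :: "complex \<Rightarrow> complex"
      proof -
        have "\<bar>Re (G z) - Re (G z0)\<bar> \<le> norm (G z - G z0)" using abs_Re_le_cmod[of "G z - G z0"] by simp
        also have "\<dots> \<le> norm (G z - G z1) + norm (G z1 - G z0)"
          using norm_triangle_ineq[of "G z - G z1" "G z1 - G z0"] by simp
        also have "\<dots> \<le> 720 * sqrt t" using that t1 by linarith
        finally show ?thesis .
      qed
      have tot1: "\<bar>Re (G1 z) - t\<bar> \<le> 720 * sqrt t" using tot[OF lip[OF G(1) GB1] d1] G1z0 by simp
      have tot2: "Re (G2 z) \<le> t / 2 + ln (2 * sqrt C) + 720 * sqrt t"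
        using tot[OF lip[OF G(2) GB(2)] d2] G2z0 by (simp add: abs_le_iff)
      have Kt: "720 * sqrt t + \<bar>ln (2 * sqrt C)\<bar> \<le> K * sqrt t"
        using t1 mult_left_mono[OF t1, of "\<bar>ln (2 * sqrt C)\<bar>"] by (simp add: K_def algebra_simps)
      show "Re z > 0 \<and> \<bar>ln (norm (\<phi> z)) - t\<bar> \<le> K * sqrt t \<and> ln (norm (deriv \<phi> z)) \<le> t / 2 + K * sqrt t"
      proof (intro conjI)
        show "\<bar>ln (norm (\<phi> z)) - t\<bar> \<le> K * sqrt t"
          using tot1 Kt unfolding G(3)[OF z_pos] norm_exp_eq_Re ln_exp by linarith
        show "ln (norm (deriv \<phi> z)) \<le> t / 2 + K * sqrt t"
          using tot2 Kt unfolding G(4)[OF z_pos] norm_exp_eq_Re ln_exp by linarith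
      qed (rule z_pos)
    qed
  qed
  show ?thesis
    by (rule exI[of _ K], rule exI[of _ "max T 1"]) (use main K in auto)
qed

section \<open>Logarithmic tracts and nested orbits\<close>

text \<open>
  The lift \<open>\<phi>\<close> of \<open>exp (z + L)\<close> through the covering \<open>f\<close> is injective because a logarithm \<open>g\<close> of \<open>f\<close> on
  the simply connected tract inverts it up to a constant. The same \<open>g\<close> shows that \<open>\<phi>\<close> is unbounded on
  vertical lines: a finite limit point of \<open>\<phi>\<close> along such a line would be in the tract, where \<open>g\<close> is
  continuous. Choosing \<open>exp L > \<bar>f 0\<bar>\<close> keeps \<open>0\<close> out of the image.
\<close>
lemma log_tract_uniformization:
  assumes hol: "f holomorphic_on UNIV" and log: "has_log_singularity_over_infinity f"
  shows "\<exists>\<phi> (L::real). \<phi> holomorphic_on {z. Re z > 0} \<and> inj_on \<phi> {z. Re z > 0} \<and>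
    (\<forall>z. Re z > 0 \<longrightarrow> \<phi> z \<noteq> 0 \<and> f (\<phi> z) = exp (z + of_real L)) \<and>
    (\<forall>s M. s > 0 \<longrightarrow> (\<exists>y. norm (\<phi> (Complex s y)) > M))"
proof -
  let ?H = "{z. Re z > 0}"
  obtain R U where R: "R > 0" and U: "U \<in> components {z. norm (f z) > R}"
    and cov: "covering_space U f {w. norm w > R}" and sc: "simply_connected U"
    using log unfolding has_log_singularity_over_infinity_def universal_covering_def by blast
  define V where "V = {z. norm (f z) > R}"
  have contf: "continuous_on S f" for S
    using holomorphic_on_imp_continuous_on[OF hol] continuous_on_subset by blast
  have "open V" unfolding V_def by (intro open_Collect_less continuous_intros contf)
  then have oU: "open U" using U open_components V_def by blast
  have UV: "U \<subseteq> V" using U in_components_subset V_def by blast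
  have holU: "f holomorphic_on U" using hol holomorphic_on_subset by blast
  have "f z \<noteq> 0" if "z \<in> U" for z using that UV R by (auto simp: V_def)
  then obtain g where g: "g holomorphic_on U" "\<And>z. z \<in> U \<Longrightarrow> f z = exp (g z)"
    using simply_connected_imp_holomorphic_log[OF holU sc open_imp_locally_path_connected[OF oU]] by blast
  define L where "L = ln (R + norm (f 0))"
  have expL: "exp L = R + norm (f 0)" using R by (simp add: L_def add_pos_nonneg)
  have H: "simply_connected ?H" "locally path_connected ?H" "open ?H" "convex ?H"
    by (auto simp: open_halfspace_Re_gt convex_halfspace_Re_gt 
        intro!: convex_imp_simply_connected open_imp_locally_path_connected)
  have norm_exp: "norm (exp (z + of_real L)) = exp (Re z) * exp L" for z
    unfolding norm_exp_eq_Re by (simp add: exp_add)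
  have big: "norm (exp (z + of_real L)) > R + norm (f 0)" if "Re z > 0" for z
    using that expL R unfolding norm_exp by (simp add: add_pos_nonneg)
  have "(\<lambda>z. exp (z + of_real L)) holomorphic_on ?H" by (intro holomorphic_intros)
  moreover have "(\<lambda>z. exp (z + of_real L)) \<in> ?H \<rightarrow> {w. norm w > R}"
    using big norm_ge_zero[of "f 0"] by (force simp del: norm_ge_zero)
  ultimately obtain \<phi> where \<phi>: "\<phi> holomorphic_on ?H" "\<phi> \<in> ?H \<rightarrow> U" 
    "\<And>z. z \<in> ?H \<Longrightarrow> f (\<phi> z) = exp (z + of_real L)"
    using covering_space_lift_holomorphic[OF cov oU holU _ _ H(1,2)] by metis
  \<comment> \<open>\<open>d\<close> takes values in the discrete set \<open>2\<pi>i\<int>\<close>, so it is constant\<close>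
  define d where "d z = g (\<phi> z) - (z + of_real L)" for z
  have hold: "d holomorphic_on ?H"
    unfolding d_def using \<phi>(2) 
    by (intro holomorphic_intros holomorphic_on_compose_gen[OF \<phi>(1) g(1), unfolded o_def]) auto
  have expd: "exp (d z) = 1" if "z \<in> ?H" for z
  proof -
    have "\<phi> z \<in> U" using \<phi>(2) that by blast
    then have "exp (g (\<phi> z)) = exp (z + of_real L)" using g(2) \<phi>(3)[OF that] by metis
    then show ?thesis by (simp add: d_def exp_diff)
  qed
  have "\<exists>c. \<forall>z\<in>?H. d z = c"
  proof (rule has_field_derivative_zero_constant[OF H(4)])
    fix z assume z: "z \<in> ?H"
    have "((\<lambda>z. exp (d z)) has_field_derivative exp (d z) * deriv d z) (at z)"
      using holomorphic_derivI[OF hold H(3) z] by (auto intro!: derivative_eq_intros)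
    moreover have "((\<lambda>z. exp (d z)) has_field_derivative 0) (at z)"
      by (rule has_field_derivative_transform_within_open[OF DERIV_const H(3) z]) (use expd in auto)
    ultimately have "exp (d z) * deriv d z = 0" by (rule DERIV_unique)
    then have "deriv d z = 0" by simp
    then show "(d has_field_derivative 0) (at z within ?H)"
      using holomorphic_derivI[OF hold H(3) z] by (simp add: has_field_derivative_at_within)
  qed
  then obtain c where c: "\<And>z. z \<in> ?H \<Longrightarrow> d z = c" by blast
  then have gphi: "g (\<phi> z) = z + (of_real L + c)" if "z \<in> ?H" for z
  proof -
    have "g (\<phi> z) = d z + (z + of_real L)" by (simp add: d_def)
    then show ?thesis unfolding c[OF that] by (simp only: ac_simps)
  qed
  have inj: "inj_on \<phi> ?H"
  proof (rule inj_onI)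
    fix z w assume zw: "z \<in> ?H" "w \<in> ?H" "\<phi> z = \<phi> w"
    have "g (\<phi> z) = g (\<phi> w)" using zw(3) by (rule arg_cong)
    then show "z = w" unfolding gphi[OF zw(1)] gphi[OF zw(2)] by simp
  qed
  have nz: "\<phi> z \<noteq> 0" if "z \<in> ?H" for z
  proof
    assume "\<phi> z = 0"
    then show False using \<phi>(3)[OF that] big[of z] that R by simp
  qed
  have unb: "\<exists>y. norm (\<phi> (Complex s y)) > M" if s: "s > 0" for s M
  proof (rule ccontr)
    assume "\<not> ?thesis"
    then have bd: "norm (\<phi> (Complex s y)) \<le> M" for y using not_le by blast
    define p where "p n = \<phi> (Complex s (real n))" for n :: nat
    have inH: "Complex s y \<in> ?H" for y using s by simp
    have "\<forall>n. p n \<in> cball 0 M" using bd by (simp add: p_def)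
    then obtain a r where a: "strict_mono (r :: nat \<Rightarrow> nat)" "(p \<circ> r) \<longlonglongrightarrow> a"
      using compact_cball[of "0::complex" M] unfolding compact_def by metis
    have pU: "(p \<circ> r) n \<in> U" for n using \<phi>(2) inH by (auto simp: p_def)
    have "isCont f a" using contf[of UNIV] by (simp add: continuous_on_eq_continuous_at)
    then have "(\<lambda>n. f ((p \<circ> r) n)) \<longlonglongrightarrow> f a" using a(2) by (rule isCont_tendsto_compose)
    then have "(\<lambda>n. norm (f ((p \<circ> r) n))) \<longlonglongrightarrow> norm (f a)" by (rule tendsto_norm)
    moreover have "norm (f ((p \<circ> r) n)) = exp s * exp L" for n
      using \<phi>(3)[OF inH] by (simp add: p_def norm_exp del: norm_exp_eq_Re)
    ultimately have "norm (f a) = exp s * exp L" by (simp add: LIMSEQ_const_iff)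
    moreover have "exp s * exp L > R"
      using big[of "of_real s"] s norm_ge_zero[of "f 0"] unfolding norm_exp by (simp del: norm_ge_zero)
    ultimately have aV: "a \<in> V" by (simp add: V_def)
    have "closedin (top_of_set V) U" using U closedin_component V_def by blast
    then obtain T where T: "closed T" "U = V \<inter> T" by (auto simp: closedin_closed)
    have "a \<in> T" using T pU a(2) closed_sequentially[of T "p \<circ> r" a] by blast
    then have aU: "a \<in> U" using T aV by blast
    then have "isCont g a"
      using holomorphic_on_imp_continuous_on[OF g(1)] oU by (simp add: continuous_on_eq_continuous_at)
    then have "(\<lambda>n. g ((p \<circ> r) n)) \<longlonglongrightarrow> g a" using a(2) by (rule isCont_tendsto_compose)
    then have "bounded (range (\<lambda>n. g ((p \<circ> r) n)))" by (rule convergent_imp_bounded)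
    then obtain B where B: "norm (g ((p \<circ> r) n)) \<le> B" for n by (auto simp: bounded_iff)
    obtain n :: nat where n: "B + norm (of_real L + c) < real n" using reals_Archimedean2 by blast
    have "real n \<le> real (r n)" using seq_suble[OF a(1), of n] by simp
    also have "\<dots> \<le> norm (Complex s (real (r n)))" using abs_Im_le_cmod[of "Complex s (real (r n))"] by simp
    also have "Complex s (real (r n)) = g ((p \<circ> r) n) - (of_real L + c)"
      using gphi[OF inH, of "real (r n)"] by (simp add: p_def)
    also have "norm \<dots> \<le> norm (g ((p \<circ> r) n)) + norm (of_real L + c)" by (rule norm_triangle_ineq4)
    also have "\<dots> \<le> B + norm (of_real L + c)" using B by simp
    finally show False using n by simp
  qed
  show ?thesis
    using \<phi>(1) inj nz \<phi>(3) unb by (intro exI[of _ \<phi>] exI[of _ L]) auto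
qed

lemma exists_logarithm_near_height:
  assumes "w \<noteq> 0"
  obtains z where "exp z = w" "\<bar>Im z - y\<bar> \<le> pi"
proof
  have nz: "w * cis (-y) \<noteq> 0" using assms by simp
  show "exp (Ln (w * cis (-y)) + \<i> * of_real y) = w"
    using nz by (simp add: exp_add mult.assoc cis_mult flip: cis_conv_exp)
  have "\<bar>Im (Ln (w * cis (-y)))\<bar> \<le> pi"
    using Im_Ln_le_pi[OF nz] mpi_less_Im_Ln[OF nz] by (simp add: abs_le_iff)
  then show "\<bar>Im (Ln (w * cis (-y)) + \<i> * of_real y) - y\<bar> \<le> pi" by simp
qed

text \<open>Each point of \<open>A n\<close> is reached by a finite orbit through \<open>A 0\<close>, ..., \<open>A (n - 1)\<close>; compactness does the rest.\<close>
lemma nested_orbit: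
  fixes f :: "complex \<Rightarrow> complex" and A :: "nat \<Rightarrow> complex set"
  assumes contf: "continuous_on UNIV f" and A: "\<And>n. compact (A n)"
    and cover: "\<And>n. A (Suc n) \<subseteq> f ` A n" and ne: "\<And>n. A n \<noteq> {}"
  shows "\<exists>z. \<forall>n. (f ^^ n) z \<in> A n"
proof -
  define C where "C n = {z. \<forall>j\<le>n. (f ^^ j) z \<in> A j}" for n
  have contn: "continuous_on UNIV (f ^^ n)" for n
  proof (induction n)
    case (Suc n)
    then show ?case using continuous_on_compose2[OF contf, of UNIV "f ^^ n"] by simp
  qed (simp add: continuous_on_id)
  have onto: "\<exists>z \<in> C n. (f ^^ n) z = w" if "w \<in> A n" for n w
    using that
  proof (induction n arbitrary: w)
    case 0
    then show ?case by (auto simp: C_def)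
  next
    case (Suc n)
    then obtain u where u: "u \<in> A n" "w = f u" using cover by blast
    obtain z where z: "z \<in> C n" "(f ^^ n) z = u" using Suc.IH[OF u(1)] by blast
    then have "(f ^^ Suc n) z = w" using u by simp
    moreover have "z \<in> C (Suc n)"
      using z(1) Suc.prems \<open>(f ^^ Suc n) z = w\<close> unfolding C_def le_Suc_eq by auto
    ultimately show ?case by blast
  qed
  have "\<Inter> (range C) \<noteq> {}"
  proof (rule compact_nest)
    fix n
    have "C n = A 0 \<inter> (\<Inter>j\<in>{..n}. (f ^^ j) -` A j)" by (auto simp: C_def)
    moreover have "closed ((f ^^ j) -` A j)" for j
      using contn A continuous_closed_vimage compact_imp_closed
      by (metis continuous_on_eq_continuous_at open_UNIV iso_tuple_UNIV_I)
    ultimately show "compact (C n)" using A by (auto intro!: compact_Int_closed closed_INT)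
    show "C n \<noteq> {}" using onto ne by blast
  next
    fix m n :: nat assume "m \<le> n"
    then show "C n \<subseteq> C m" by (auto simp: C_def)
  qed
  then show ?thesis by (auto simp: C_def)
qed

lemma funpow_holomorphic: "f holomorphic_on UNIV \<Longrightarrow> (f ^^ n) holomorphic_on UNIV"
proof (induction n)
  case (Suc n)
  then show ?case using holomorphic_on_compose_gen[of "f ^^ n" UNIV f UNIV] by (simp add: o_def)
qed simp

lemma deriv_compose_entire:
  assumes "f holomorphic_on UNIV" "g holomorphic_on UNIV"
  shows "deriv (f \<circ> g) z = deriv f (g z) * deriv g z"
  by (rule deriv_chain; rule holomorphic_on_imp_differentiable_at[OF _ open_UNIV UNIV_I]; fact assms)

lemma deriv_funpow:
  assumes "f holomorphic_on UNIV"
  shows "deriv (f ^^ n) z = (\<Prod>j<n. deriv f ((f ^^ j) z))"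
proof (induction n)
  case (Suc n)
  have "deriv (f ^^ Suc n) z = deriv f ((f ^^ n) z) * deriv (f ^^ n) z"
    using deriv_compose_entire[OF assms funpow_holomorphic[OF assms]] by (simp only: funpow.simps)
  with Suc show ?case by (simp add: mult.commute o_def)
qed simp

section \<open>Orbits with doubly exponential expansion\<close>

text \<open>
  A growth condition with the required rate \<open>ln (3/2)\<close> that is stable under passing to preimages: the
  factor \<open>\<kappa>\<close> absorbs a shift of \<open>n\<close> and the constant from the chain rule, and the power of \<open>n\<close> leaves
  room for the error terms.
\<close>
definition expands_doubly_exponentially :: "(complex \<Rightarrow> complex) \<Rightarrow> complex \<Rightarrow> bool" where
  "expands_doubly_exponentially f z \<longleftrightarrow>
     (\<exists>\<kappa>>0. \<forall>\<^sub>F n in sequentially. exp (\<kappa> * (3 / 2) ^ n / real n ^ 3) \<le> spherical_deriv (f ^^ n) z)"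

lemma expands_doubly_exponentially_unbounded:
  assumes "expands_doubly_exponentially f z"
  shows "\<forall>\<^sub>F n in sequentially. M < spherical_deriv (f ^^ n) z"
proof -
  obtain \<kappa> where \<kappa>: "\<kappa> > 0" "\<forall>\<^sub>F n in sequentially. exp (\<kappa> * (3 / 2) ^ n / real n ^ 3) \<le> spherical_deriv (f ^^ n) z"
    using assms unfolding expands_doubly_exponentially_def by blast
  have "filterlim (\<lambda>n. exp (\<kappa> * (3 / 2) ^ n / real n ^ 3)) at_top sequentially"
    using \<kappa>(1) by real_asymp
  then have "\<forall>\<^sub>F n in sequentially. M < exp (\<kappa> * (3 / 2) ^ n / real n ^ 3)"
    by (simp add: filterlim_at_top_dense)
  with \<kappa>(2) show ?thesis by eventually_elim linarith
qed

lemma expands_doubly_exponentially_liminf: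
  assumes "expands_doubly_exponentially f z"
  shows "liminf (\<lambda>n. ereal (1 / real n * ln (ln (spherical_deriv (f ^^ n) z)))) \<ge> ereal (ln (3 / 2))"
proof -
  obtain \<kappa> where \<kappa>: "\<kappa> > 0" "\<forall>\<^sub>F n in sequentially. exp (\<kappa> * (3 / 2) ^ n / real n ^ 3) \<le> spherical_deriv (f ^^ n) z"
    using assms unfolding expands_doubly_exponentially_def by blast
  have "(\<lambda>n. 1 / real n * ln (\<kappa> * (3 / 2) ^ n / real n ^ 3)) \<longlonglongrightarrow> ln (3 / 2)"
    using \<kappa>(1) by real_asymp
  then have "(\<lambda>n. ereal (1 / real n * ln (\<kappa> * (3 / 2) ^ n / real n ^ 3))) \<longlonglongrightarrow> ereal (ln (3 / 2))"
    by simp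
  then have "ereal (ln (3 / 2)) = liminf (\<lambda>n. ereal (1 / real n * ln (\<kappa> * (3 / 2) ^ n / real n ^ 3)))"
    by (intro lim_imp_Liminf[symmetric]) simp
  also have "\<dots> \<le> liminf (\<lambda>n. ereal (1 / real n * ln (ln (spherical_deriv (f ^^ n) z))))"
  proof (rule Liminf_mono)
    show "\<forall>\<^sub>F n in sequentially. ereal (1 / real n * ln (\<kappa> * (3 / 2) ^ n / real n ^ 3))
        \<le> ereal (1 / real n * ln (ln (spherical_deriv (f ^^ n) z)))"
      using \<kappa>(2) eventually_gt_at_top[of "0::nat"]
    proof eventually_elim
      case (elim n)
      define a where "a = \<kappa> * (3 / 2) ^ n / real n ^ 3"
      have a: "a > 0" using \<kappa>(1) elim by (simp add: a_def)
      have "a \<le> ln (spherical_deriv (f ^^ n) z)"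
        using elim(1) unfolding a_def[symmetric] by (subst ln_ge_iff) (use order_less_le_trans[OF exp_gt_zero] in auto)
      then have "ln a \<le> ln (ln (spherical_deriv (f ^^ n) z))" using a by simp
      then have "1 / real n * ln a \<le> 1 / real n * ln (ln (spherical_deriv (f ^^ n) z))"
        by (intro mult_left_mono) auto
      then show ?case unfolding a_def[symmetric] by simp
    qed
  qed
  finally show ?thesis .
qed

lemma spherical_deriv_funpow_add:
  assumes "f holomorphic_on UNIV"
  shows "spherical_deriv (f ^^ (k + m)) v = spherical_deriv (f ^^ k) ((f ^^ m) v) * norm (deriv (f ^^ m) v)"
  using deriv_compose_entire[OF funpow_holomorphic[OF assms, of k] funpow_holomorphic[OF assms, of m], of v]
  unfolding spherical_deriv_def funpow_add by (simp add: norm_mult)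

lemma expands_doubly_exponentially_pullback:
  assumes hol: "f holomorphic_on UNIV" and fast: "expands_doubly_exponentially f ((f ^^ m) v)"
    and nz: "deriv (f ^^ m) v \<noteq> 0"
  shows "expands_doubly_exponentially f v"
proof -
  obtain \<kappa> where \<kappa>: "\<kappa> > 0" 
    "\<forall>\<^sub>F k in sequentially. exp (\<kappa> * (3 / 2) ^ k / real k ^ 3) \<le> spherical_deriv (f ^^ k) ((f ^^ m) v)"
    using fast unfolding expands_doubly_exponentially_def by blast
  define c where "c = ln (norm (deriv (f ^^ m) v))"
  define \<mu> where "\<mu> = \<kappa> * (2 / 3) ^ m / 2"
  have \<mu>: "\<mu> > 0" using \<kappa>(1) by (simp add: \<mu>_def)
  have "\<forall>\<^sub>F k in sequentially. exp (\<mu> * (3 / 2) ^ (k + m) / real (k + m) ^ 3) \<le> spherical_deriv (f ^^ (k + m)) v"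
  proof -
    have "\<forall>\<^sub>F k in sequentially. \<mu> * (3 / 2) ^ (k + m) / real (k + m) ^ 3 \<ge> - c"
    proof -
      have "filterlim (\<lambda>k. \<mu> * (3 / 2) ^ (k + m) / (real k + real m) ^ 3) at_top sequentially"
        using \<mu> by real_asymp
      then show ?thesis by (simp add: filterlim_at_top)
    qed
    then show ?thesis using \<kappa>(2) eventually_gt_at_top[of "0::nat"]
    proof eventually_elim
      case (elim k)
      let ?a = "(3 / 2) ^ (k + m) / real (k + m) ^ 3 :: real"
      have "\<kappa> * (2 / 3) ^ m * (3 / 2) ^ (k + m) = \<kappa> * (3 / 2) ^ k * ((2 / 3) ^ m * (3 / 2 :: real) ^ m)"
        by (simp add: power_add)
      also have "(2 / 3) ^ m * (3 / 2 :: real) ^ m = 1" by (simp flip: power_mult_distrib)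
      finally have "2 * \<mu> * (3 / 2) ^ (k + m) = \<kappa> * (3 / 2) ^ k" by (simp add: \<mu>_def)
      then have "2 * (\<mu> * (3 / 2) ^ (k + m) / real (k + m) ^ 3) = \<kappa> * (3 / 2) ^ k / real (k + m) ^ 3" by simp
      also have "\<dots> \<le> \<kappa> * (3 / 2) ^ k / real k ^ 3"
        using \<kappa>(1) elim(3) by (intro divide_left_mono power_mono mult_pos_pos) auto
      finally have "\<mu> * (3 / 2) ^ (k + m) / real (k + m) ^ 3 \<le> \<kappa> * (3 / 2) ^ k / real k ^ 3 + c"
        using elim(1) by linarith
      then have "exp (\<mu> * (3 / 2) ^ (k + m) / real (k + m) ^ 3) \<le> exp (\<kappa> * (3 / 2) ^ k / real k ^ 3) * exp c"
        by (simp flip: exp_add)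
      also have "exp c = norm (deriv (f ^^ m) v)" using nz by (simp add: c_def)
      also have "exp (\<kappa> * (3 / 2) ^ k / real k ^ 3) * norm (deriv (f ^^ m) v) \<le> spherical_deriv (f ^^ (k + m)) v"
        unfolding spherical_deriv_funpow_add[OF hol] using elim(2) by (intro mult_right_mono) auto
      finally show ?case .
    qed
  qed
  then have "\<forall>\<^sub>F n in sequentially. exp (\<mu> * (3 / 2) ^ n / real n ^ 3) \<le> spherical_deriv (f ^^ n) v"
    by (rule eventually_sequentially_seg[THEN iffD1])
  then show ?thesis unfolding expands_doubly_exponentially_def using \<mu> by blast
qed

text \<open>
  The logarithmic size of the orbit. The denominator makes consecutive ratios slightly smaller than
  the critical \<open>3/2\<close>; the summand \<open>3\<close> keeps them at least \<open>1\<close> from the start.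
\<close>
definition log_radius :: "real \<Rightarrow> nat \<Rightarrow> real" where
  "log_radius \<theta> n = \<theta> * (3 / 2) ^ n / (real n + 3)"

lemma log_radius_pos: "\<theta> > 0 \<Longrightarrow> log_radius \<theta> n > 0"
  by (simp add: log_radius_def add_nonneg_pos)

lemma log_radius_Suc:
  assumes "\<theta> > 0"
  shows "log_radius \<theta> n \<le> log_radius \<theta> (Suc n)" "log_radius \<theta> (Suc n) \<le> 2 * log_radius \<theta> n"
proof -
  define a where "a = \<theta> * (3 / 2) ^ n"
  have a: "a > 0" using assms by (simp add: a_def)
  have e: "log_radius \<theta> n = a / (real n + 3)" "log_radius \<theta> (Suc n) = a * (3 / 2) / (real n + 4)"
    by (simp_all add: log_radius_def a_def add.commute)
  show "log_radius \<theta> n \<le> log_radius \<theta> (Suc n)" "log_radius \<theta> (Suc n) \<le> 2 * log_radius \<theta> n"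
    unfolding e using a by (simp_all add: field_simps)
qed

lemma log_radius_mono: "\<theta> > 0 \<Longrightarrow> m \<le> n \<Longrightarrow> log_radius \<theta> m \<le> log_radius \<theta> n"
  using lift_Suc_mono_le[of "log_radius \<theta>"] log_radius_Suc(1) by blast

text \<open>
  The left-hand side grows with \<open>n\<close>: its increments are \<open>3/2 t\<^sub>n - t\<^sub>n\<^sub>+\<^sub>1\<close>, and already the last one has
  the claimed order.
\<close>
lemma log_radius_gain:
  assumes \<theta>: "\<theta> > 0"
  shows "(\<Sum>j<n. log_radius \<theta> (Suc j) - log_radius \<theta> j / 2) - 2 * log_radius \<theta> n
     \<ge> \<theta> * (3 / 2) ^ n / ((real n + 2) * (real n + 3)) - 2 * \<theta>"
proof -
  define S where "S n = (\<Sum>j<n. log_radius \<theta> (Suc j) - log_radius \<theta> j / 2) - 2 * log_radius \<theta> n" for n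
  have step: "S (Suc n) = S n + \<theta> * (3 / 2) ^ Suc n / ((real n + 3) * (real n + 4))" for n
  proof -
    define a where "a = \<theta> * (3 / 2) ^ n"
    have e: "log_radius \<theta> n = a / (real n + 3)" "log_radius \<theta> (Suc n) = a * (3 / 2) / (real n + 4)"
      by (simp_all add: log_radius_def a_def add.commute)
    have "S (Suc n) = S n + (3 / 2 * log_radius \<theta> n - log_radius \<theta> (Suc n))" by (simp add: S_def)
    also have "3 / 2 * log_radius \<theta> n - log_radius \<theta> (Suc n) = (3 / 2 * a) / ((real n + 3) * (real n + 4))"
    proof -
      define p where "p = real n + 3"
      have "3 / 2 * (a / p) - a * (3 / 2) / (p + 1) = 3 / 2 * a / (p * (p + 1))"
        using p_def by (simp add: divide_simps) (simp add: algebra_simps)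
      moreover have "real n + 4 = p + 1" by (simp add: p_def)
      ultimately show ?thesis unfolding e by (simp only: p_def)
    qed
    finally show ?thesis by (simp add: a_def mult_ac)
  qed
  have low: "S n \<ge> - 2 * \<theta>" for n
  proof (induction n)
    case 0
    then show ?case using \<theta> by (simp add: S_def log_radius_def)
  next
    case (Suc n)
    have "0 \<le> \<theta> * (3 / 2) ^ Suc n / ((real n + 3) * (real n + 4))" using \<theta> by simp
    with Suc show ?case unfolding step by linarith
  qed
  have "S n \<ge> \<theta> * (3 / 2) ^ n / ((real n + 2) * (real n + 3)) - 2 * \<theta>"
  proof (cases n)
    case 0
    then show ?thesis using \<theta> by (simp add: S_def log_radius_def)
  next
    case (Suc m)
    then show ?thesis using low[of m] step[of m] by (simp add: add.commute add.left_commute)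
  qed
  then show ?thesis by (simp add: S_def)
qed

text \<open>
  The error terms add up to \<open>O(n sqrt t\<^sub>n)\<close>, which is negligible against the gain of order
  \<open>(3/2)\<^sup>n / n\<^sup>2\<close> because \<open>sqrt t\<^sub>n\<close> grows only like \<open>(3/2)\<close> to the power \<open>n/2\<close>.
\<close>
lemma rapid_orbit_expands:
  assumes hol: "f holomorphic_on UNIV" and \<theta>: "\<theta> \<ge> 1" and K: "K \<ge> 0"
    and size: "\<And>n. \<bar>ln (norm ((f ^^ n) z)) - log_radius \<theta> n\<bar> \<le> K * sqrt (log_radius \<theta> n)"
    and nz: "\<And>n. (f ^^ n) z \<noteq> 0" and nz': "\<And>n. deriv f ((f ^^ n) z) \<noteq> 0"
    and der: "\<And>n. ln (norm (deriv f ((f ^^ n) z))) \<ge> log_radius \<theta> (Suc n) - log_radius \<theta> n / 2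
          - K * sqrt (log_radius \<theta> (Suc n)) - K * sqrt (log_radius \<theta> n)"
  shows "expands_doubly_exponentially f z"
proof -
  define t where "t = log_radius \<theta>"
  have t0: "t n > 0" for n using log_radius_pos[of \<theta> n] \<theta> by (simp add: t_def)
  have mono: "sqrt (t m) \<le> sqrt (t n)" if "m \<le> n" for m n
    using log_radius_mono[of \<theta> m n] \<theta> that by (simp add: t_def)
  have bound: "ln (spherical_deriv (f ^^ n) z) \<ge> \<theta> * (3 / 2) ^ n / ((real n + 2) * (real n + 3)) - 2 * \<theta>
      - 2 * K * (real n + 1) * sqrt (t n) - ln 2 \<and> spherical_deriv (f ^^ n) z > 0" for n
  proof
    have dnz: "norm (deriv (f ^^ n) z) > 0" using nz' by (simp add: deriv_funpow[OF hol])
    then show "spherical_deriv (f ^^ n) z > 0" unfolding spherical_deriv_def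
      by (intro divide_pos_pos add_pos_nonneg) auto
    have "ln (norm (deriv (f ^^ n) z)) = (\<Sum>j<n. ln (norm (deriv f ((f ^^ j) z))))"
      using nz' by (simp add: deriv_funpow[OF hol] prod_norm[symmetric] ln_prod)
    also have "\<dots> \<ge> (\<Sum>j<n. t (Suc j) - t j / 2 - 2 * K * sqrt (t n))"
    proof (rule sum_mono)
      fix j assume "j \<in> {..<n}"
      then have "K * sqrt (t (Suc j)) \<le> K * sqrt (t n)" "K * sqrt (t j) \<le> K * sqrt (t n)"
        using K by (auto intro!: mult_left_mono mono)
      then show "t (Suc j) - t j / 2 - 2 * K * sqrt (t n) \<le> ln (norm (deriv f ((f ^^ j) z)))"
        using der[of j] unfolding t_def by linarith
    qed
    also have "(\<Sum>j<n. t (Suc j) - t j / 2 - 2 * K * sqrt (t n)) =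
       (\<Sum>j<n. t (Suc j) - t j / 2) - 2 * K * real n * sqrt (t n)"
      by (simp add: sum_subtractf)
    finally have 1: "(\<Sum>j<n. t (Suc j) - t j / 2) - 2 * K * real n * sqrt (t n) \<le> ln (norm (deriv (f ^^ n) z))" .
    define b where "b = t n + K * sqrt (t n)"
    have b: "b \<ge> 0" using t0[of n] K by (simp add: b_def)
    have "norm ((f ^^ n) z) \<le> exp b"
    proof -
      have "ln (norm ((f ^^ n) z)) \<le> b" using size[of n] unfolding b_def t_def by linarith
      then show ?thesis using nz[of n] by (metis exp_le_cancel_iff exp_ln zero_less_norm_iff)
    qed
    then have "1 + (norm ((f ^^ n) z))\<^sup>2 \<le> 1 + (exp b)\<^sup>2" by (simp add: power_mono)
    also have "\<dots> \<le> 2 * exp (2 * b)" using b by (simp add: exp_double)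
    finally have "ln (1 + (norm ((f ^^ n) z))\<^sup>2) \<le> ln (2 * exp (2 * b))"
      by (subst ln_le_cancel_iff) (auto intro: add_pos_nonneg)
    then have 2: "ln (1 + (norm ((f ^^ n) z))\<^sup>2) \<le> ln 2 + 2 * b" by (simp add: ln_mult)
    have "ln (spherical_deriv (f ^^ n) z) = ln (norm (deriv (f ^^ n) z)) - ln (1 + (norm ((f ^^ n) z))\<^sup>2)"
    proof -
      have "1 + (norm ((f ^^ n) z))\<^sup>2 > 0" by (intro add_pos_nonneg) auto
      then show ?thesis unfolding spherical_deriv_def using dnz by (intro ln_divide_pos)
    qed
    moreover have "(\<Sum>j<n. t (Suc j) - t j / 2) - 2 * t n \<ge> \<theta> * (3 / 2) ^ n / ((real n + 2) * (real n + 3)) - 2 * \<theta>"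
      unfolding t_def using log_radius_gain[of \<theta> n] \<theta> by simp
    moreover have "2 * K * (real n + 1) * sqrt (t n) = 2 * K * real n * sqrt (t n) + 2 * (K * sqrt (t n))"
      by (simp add: algebra_simps)
    ultimately show "ln (spherical_deriv (f ^^ n) z) \<ge> \<theta> * (3 / 2) ^ n / ((real n + 2) * (real n + 3)) - 2 * \<theta>
      - 2 * K * (real n + 1) * sqrt (t n) - ln 2"
      using 1 2 unfolding b_def by argo
  qed
  have "\<theta> > 0" using \<theta> by simp
  then have "\<forall>\<^sub>F n in sequentially. \<theta> * (3 / 2) ^ n / real n ^ 3 \<le> 
      \<theta> * (3 / 2) ^ n / ((real n + 2) * (real n + 3)) - 2 * \<theta>
      - 2 * K * (real n + 1) * sqrt (\<theta> * (3 / 2) ^ n / (real n + 3)) - ln 2"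
    by real_asymp
  then have "\<forall>\<^sub>F n in sequentially. exp (\<theta> * (3 / 2) ^ n / real n ^ 3) \<le> spherical_deriv (f ^^ n) z"
  proof eventually_elim
    case (elim n)
    then have "\<theta> * (3 / 2) ^ n / real n ^ 3 \<le> ln (spherical_deriv (f ^^ n) z)"
      using bound[of n] unfolding t_def log_radius_def by linarith
    then show ?case using bound[of n] by (simp add: ln_ge_iff)
  qed
  then show ?thesis unfolding expands_doubly_exponentially_def using \<open>\<theta> > 0\<close> by blast
qed

text \<open>
  The tame rectangles \<open>Q n\<close> are chosen such that \<open>f\<close> maps \<open>\<phi> ` Q n\<close> onto the annulus of points whose
  logarithmic modulus is close to \<open>t\<^sub>n\<^sub>+\<^sub>1\<close>, and \<open>\<phi> ` Q (n + 1)\<close> lies in this annulus.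
\<close>
lemma rapid_orbit_exists:
  assumes hol: "f holomorphic_on UNIV" and log: "has_log_singularity_over_infinity f"
  shows "\<exists>K \<theta>0. \<forall>\<theta>\<ge>\<theta>0. \<exists>z. expands_doubly_exponentially f z \<and> 
     (\<forall>n. \<bar>ln (norm ((f ^^ n) z)) - log_radius \<theta> n\<bar> \<le> K * sqrt (log_radius \<theta> n))"
proof -
  obtain \<phi> and L :: real where \<phi>: "\<phi> holomorphic_on {z. Re z > 0}" "inj_on \<phi> {z. Re z > 0}"
    "\<And>z. Re z > 0 \<Longrightarrow> \<phi> z \<noteq> 0" "\<And>z. Re z > 0 \<Longrightarrow> f (\<phi> z) = exp (z + of_real L)"
    "\<And>s M. s > 0 \<Longrightarrow> \<exists>y. norm (\<phi> (Complex s y)) > M"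
    using log_tract_uniformization[OF hol log] by blast
  obtain K T where K: "K \<ge> 0" and T: "T \<ge> 1" and tame: "\<And>t t'. T \<le> t \<Longrightarrow> t \<le> t' \<Longrightarrow> t' \<le> 2 * t \<Longrightarrow>
    \<exists>y. \<forall>z. \<bar>Re z + L - t'\<bar> \<le> K * sqrt t' \<and> \<bar>Im z - y\<bar> \<le> pi \<longrightarrow>
       Re z > 0 \<and> \<bar>ln (norm (\<phi> z)) - t\<bar> \<le> K * sqrt t \<and> ln (norm (deriv \<phi> z)) \<le> t / 2 + K * sqrt t"
    using univalent_half_plane_tame_rectangle[OF \<phi>(1,2,3,5), of L] by blast
  have "\<exists>z. expands_doubly_exponentially f z \<and> 
     (\<forall>n. \<bar>ln (norm ((f ^^ n) z)) - log_radius \<theta> n\<bar> \<le> K * sqrt (log_radius \<theta> n))" if \<theta>: "\<theta> \<ge> 3 * T" for \<theta>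
  proof -
    define t where "t = log_radius \<theta>"
    have \<theta>0: "\<theta> > 0" "\<theta> \<ge> 1" using \<theta> T by auto
    have tT: "T \<le> t n" for n
    proof -
      have "T \<le> t 0" using \<theta> by (simp add: t_def log_radius_def)
      also have "\<dots> \<le> t n" unfolding t_def using log_radius_mono[OF \<theta>0(1)] by blast
      finally show ?thesis .
    qed
    have "\<forall>n. \<exists>y. \<forall>z. \<bar>Re z + L - t (Suc n)\<bar> \<le> K * sqrt (t (Suc n)) \<and> \<bar>Im z - y\<bar> \<le> pi \<longrightarrow>
       Re z > 0 \<and> \<bar>ln (norm (\<phi> z)) - t n\<bar> \<le> K * sqrt (t n) \<and> ln (norm (deriv \<phi> z)) \<le> t n / 2 + K * sqrt (t n)"
      using tame tT log_radius_Suc[OF \<theta>0(1)] unfolding t_def by blast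
    then obtain y where y: "\<And>n z. \<bar>Re z + L - t (Suc n)\<bar> \<le> K * sqrt (t (Suc n)) \<Longrightarrow> \<bar>Im z - y n\<bar> \<le> pi \<Longrightarrow>
       Re z > 0 \<and> \<bar>ln (norm (\<phi> z)) - t n\<bar> \<le> K * sqrt (t n) \<and> ln (norm (deriv \<phi> z)) \<le> t n / 2 + K * sqrt (t n)"
      by metis
    define Q where "Q n = {z. \<bar>Re z + L - t (Suc n)\<bar> \<le> K * sqrt (t (Suc n)) \<and> \<bar>Im z - y n\<bar> \<le> pi}" for n
    have QH: "Q n \<subseteq> {z. Re z > 0}" for n using y by (auto simp: Q_def)
    have Q: "compact (Q n)" "Q n \<noteq> {}" for n
    proof -
      have "Q n = cbox (Complex (t (Suc n) - L - K * sqrt (t (Suc n))) (y n - pi))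
                       (Complex (t (Suc n) - L + K * sqrt (t (Suc n))) (y n + pi))"
        by (auto simp: Q_def in_cbox_complex_iff abs_le_iff)
      then show "compact (Q n)" by simp
      have "Complex (t (Suc n) - L) (y n) \<in> Q n"
        using K tT[of "Suc n"] T by (simp add: Q_def)
      then show "Q n \<noteq> {}" by blast
    qed
    have "\<exists>z. \<forall>n. (f ^^ n) z \<in> \<phi> ` Q n"
    proof (rule nested_orbit)
      show "continuous_on UNIV f" using hol by (rule holomorphic_on_imp_continuous_on)
      show "compact (\<phi> ` Q n)" for n
        using Q(1) QH by (intro compact_continuous_image continuous_on_subset[OF holomorphic_on_imp_continuous_on[OF \<phi>(1)]])
      show "\<phi> ` Q n \<noteq> {}" for n using Q(2) by auto
      show "\<phi> ` Q (Suc n) \<subseteq> f ` \<phi> ` Q n" for n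
      proof
        fix w assume "w \<in> \<phi> ` Q (Suc n)"
        then obtain u where u: "u \<in> Q (Suc n)" "w = \<phi> u" by blast
        have "Re u > 0" using QH u(1) by blast
        have w: "w \<noteq> 0" using \<phi>(3)[OF \<open>Re u > 0\<close>] u by simp
        have lw: "\<bar>ln (norm w) - t (Suc n)\<bar> \<le> K * sqrt (t (Suc n))"
          using u y[of u "Suc n"] by (simp add: Q_def)
        obtain z where z: "exp z = w" "\<bar>Im z - y n\<bar> \<le> pi" using exists_logarithm_near_height[OF w] .
        have "Re z = ln (norm w)" unfolding z(1)[symmetric] norm_exp_eq_Re by simp
        then have zQ: "z - of_real L \<in> Q n" using lw z(2) by (simp add: Q_def)
        then have "Re (z - of_real L) > 0" using QH by blast
        from \<phi>(4)[OF this] have "f (\<phi> (z - of_real L)) = w" using z(1) by simp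
        then show "w \<in> f ` \<phi> ` Q n" using zQ by blast
      qed
    qed
    then obtain z where z: "\<And>n. (f ^^ n) z \<in> \<phi> ` Q n" by blast
    have props: "\<bar>ln (norm ((f ^^ n) z)) - t n\<bar> \<le> K * sqrt (t n) \<and> (f ^^ n) z \<noteq> 0 \<and>
       deriv f ((f ^^ n) z) \<noteq> 0 \<and> ln (norm (deriv f ((f ^^ n) z))) \<ge> t (Suc n) - t n / 2
          - K * sqrt (t (Suc n)) - K * sqrt (t n)" for n
    proof -
      obtain u where u: "u \<in> Q n" "(f ^^ n) z = \<phi> u" using z by blast
      have uH: "Re u > 0" using QH u(1) by blast
      have yu: "\<bar>ln (norm (\<phi> u)) - t n\<bar> \<le> K * sqrt (t n)" "ln (norm (deriv \<phi> u)) \<le> t n / 2 + K * sqrt (t n)"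
        "\<bar>Re u + L - t (Suc n)\<bar> \<le> K * sqrt (t (Suc n))"
        using u(1) y[of u n] by (auto simp: Q_def)
      have d\<phi>: "(\<phi> has_field_derivative deriv \<phi> u) (at u)"
        using holomorphic_derivI[OF \<phi>(1) open_halfspace_Re_gt, of u] uH by simp
      have df: "(f has_field_derivative deriv f (\<phi> u)) (at (\<phi> u))"
        using holomorphic_derivI[OF hol open_UNIV, of "\<phi> u"] by simp
      have "((\<lambda>z. f (\<phi> z)) has_field_derivative deriv f (\<phi> u) * deriv \<phi> u) (at u)"
        by (rule DERIV_chain2[OF df d\<phi>])
      moreover have "((\<lambda>z. f (\<phi> z)) has_field_derivative exp (u + of_real L)) (at u)"
      proof (rule has_field_derivative_transform_within_open[where S = "{z. Re z > 0}"])
        show "((\<lambda>z. exp (z + of_real L)) has_field_derivative exp (u + of_real L)) (at u)"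
          by (auto intro!: derivative_eq_intros)
      qed (use uH \<phi>(4) in \<open>auto simp: open_halfspace_Re_gt\<close>)
      ultimately have prod: "deriv f (\<phi> u) * deriv \<phi> u = exp (u + of_real L)" by (rule DERIV_unique)
      have nz1: "deriv f (\<phi> u) \<noteq> 0" "deriv \<phi> u \<noteq> 0"
        using prod exp_not_eq_zero[of "u + of_real L"] by auto
      have "Re u + L = ln (norm (deriv f (\<phi> u) * deriv \<phi> u))"
        unfolding prod norm_exp_eq_Re by simp
      also have "\<dots> = ln (norm (deriv f (\<phi> u))) + ln (norm (deriv \<phi> u))"
        using nz1 by (simp add: norm_mult ln_mult)
      finally have "Re u + L = ln (norm (deriv f (\<phi> u))) + ln (norm (deriv \<phi> u))" .
      then have "ln (norm (deriv f (\<phi> u))) \<ge> t (Suc n) - t n / 2 - K * sqrt (t (Suc n)) - K * sqrt (t n)"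
        using yu by linarith
      then show ?thesis unfolding u(2) using yu(1) nz1(1) \<phi>(3)[OF uH] by blast
    qed
    have "expands_doubly_exponentially f z"
      using props unfolding t_def by (intro rapid_orbit_expands[OF hol \<theta>0(2) K]) blast+
    then show ?thesis using props unfolding t_def by blast
  qed
  then show ?thesis by blast
qed

text \<open>For different \<open>\<theta>\<close> the sizes of the orbits eventually differ, so the points are different.\<close>
lemma uncountable_expanding_points:
  assumes hol: "f holomorphic_on UNIV" and log: "has_log_singularity_over_infinity f"
  shows "uncountable {z. expands_doubly_exponentially f z}"
proof
  assume count: "countable {z. expands_doubly_exponentially f z}"
  obtain K \<theta>0 where K\<theta>: "\<And>\<theta>. \<theta> \<ge> \<theta>0 \<Longrightarrow> \<exists>z. expands_doubly_exponentially f z \<and> 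
     (\<forall>n. \<bar>ln (norm ((f ^^ n) z)) - log_radius \<theta> n\<bar> \<le> K * sqrt (log_radius \<theta> n))"
    using rapid_orbit_exists[OF assms] by blast
  define \<theta>1 where "\<theta>1 = max \<theta>0 1"
  obtain p where p: "\<And>\<theta>. \<theta> \<ge> \<theta>0 \<Longrightarrow> expands_doubly_exponentially f (p \<theta>)"
    "\<And>\<theta> n. \<theta> \<ge> \<theta>0 \<Longrightarrow> \<bar>ln (norm ((f ^^ n) (p \<theta>))) - log_radius \<theta> n\<bar> \<le> K * sqrt (log_radius \<theta> n)"
    using K\<theta> by metis
  have less: "p a \<noteq> p b" if ab: "\<theta>1 \<le> a" "a < b" for a b
  proof
    assume eq: "p a = p b"
    have pos: "a > 0" "b > 0" "a \<ge> \<theta>0" "b \<ge> \<theta>0" using ab by (auto simp: \<theta>1_def)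
    define x where "x n = (3 / 2) ^ n / (real n + 3)" for n :: nat
    have x0: "x n > 0" for n by (simp add: x_def add_nonneg_pos)
    have lr: "log_radius c n = c * x n" for c n by (simp add: log_radius_def x_def)
    define M where "M = \<bar>K\<bar> * (sqrt a + sqrt b) + 1"
    have M: "M > 0" using pos by (simp add: M_def add_nonneg_pos)
    have le: "(b - a) * x n \<le> M * sqrt (x n)" for n
    proof -
      have "(b - a) * x n \<le> K * sqrt (a * x n) + K * sqrt (b * x n)"
        using p(2)[OF pos(3), of n] p(2)[OF pos(4), of n] unfolding eq lr left_diff_distrib by linarith
      also have "\<dots> = K * (sqrt a + sqrt b) * sqrt (x n)" by (simp add: real_sqrt_mult algebra_simps)
      also have "\<dots> \<le> M * sqrt (x n)"
      proof (rule mult_right_mono)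
        have "K * (sqrt a + sqrt b) \<le> \<bar>K\<bar> * (sqrt a + sqrt b)"
          using pos by (intro mult_right_mono add_nonneg_nonneg) auto
        then show "K * (sqrt a + sqrt b) \<le> M" unfolding M_def by linarith
      qed (use x0[of n] in simp)
      finally show ?thesis .
    qed
    have "b - a > 0" using ab by simp
    then have "\<forall>\<^sub>F n in sequentially. (b - a) * x n > M * sqrt (x n)"
      unfolding x_def using M by real_asymp
    then obtain n where "(b - a) * x n > M * sqrt (x n)"
      using eventually_happens'[OF sequentially_bot] by blast
    then show False using le[of n] by linarith
  qed
  then have "inj_on p {\<theta>1..}" 
    by (intro inj_onI) (metis atLeast_iff linorder_neqE_linordered_idom)
  moreover have "p ` {\<theta>1..} \<subseteq> {z. expands_doubly_exponentially f z}" using p(1) by (auto simp: \<theta>1_def)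
  then have "countable (p ` {\<theta>1..})" using count by (rule countable_subset)
  ultimately have "countable {\<theta>1..}" by (rule countable_image_inj_on[rotated])
  then have "countable {\<theta>1<..<\<theta>1 + 1}" by (rule countable_subset[rotated]) auto
  then show False using uncountable_open_interval[of \<theta>1 "\<theta>1 + 1"] by simp
qed

section \<open>Normal families and the Julia set\<close>

lemma snd_sphere_point: "snd (sphere_point (Some w)) = 1 - 2 / ((norm w)\<^sup>2 + 1)"
proof -
  have "(norm w)\<^sup>2 + 1 > 0" by (simp add: add_nonneg_pos)
  then show ?thesis by (simp add: field_simps)
qed

lemma continuous_on_sphere_point: "continuous_on UNIV (\<lambda>w. sphere_point (Some w))"
proof -
  have "1 + (norm w)\<^sup>2 \<noteq> 0" "(norm w)\<^sup>2 + 1 \<noteq> 0" for w :: complex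
    using zero_le_power2[of "norm w"] by linarith+
  then show ?thesis by (auto intro!: continuous_intros)
qed

lemma deriv_bound_ball:
  assumes hol: "F holomorphic_on cball z d" and d: "d > 0" and B: "\<And>w. w \<in> cball z d \<Longrightarrow> norm (F w) \<le> B"
  shows "norm (deriv F z) \<le> B / d"
  using Cauchy_inequality[of F z d B 1] holomorphic_on_subset[OF hol ball_subset_cball]
    holomorphic_on_imp_continuous_on[OF hol] d B
  by (simp add: dist_norm)

lemma spherical_deriv_bound_small:
  assumes hol: "F holomorphic_on cball z d" and d: "d > 0" and B: "\<And>w. w \<in> cball z d \<Longrightarrow> norm (F w) \<le> B"
  shows "spherical_deriv F z \<le> B / d"
proof -
  have "spherical_deriv F z \<le> norm (deriv F z) / 1"
    unfolding spherical_deriv_def by (intro divide_left_mono) (auto simp: add_nonneg_pos add_pos_nonneg)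
  then show ?thesis using deriv_bound_ball[OF assms] by simp
qed

lemma spherical_deriv_bound_large:
  assumes hol: "F holomorphic_on cball z d" and d: "d > 0" and B: "\<And>w. w \<in> cball z d \<Longrightarrow> norm (F w) \<ge> 1"
  shows "spherical_deriv F z \<le> 1 / d"
proof -
  have nz: "F w \<noteq> 0" if "w \<in> cball z d" for w using B[OF that] by auto
  have z: "z \<in> cball z d" using d by simp
  have "(\<lambda>w. inverse (F w)) holomorphic_on cball z d" using nz by (intro holomorphic_intros hol)
  moreover have "norm (inverse (F w)) \<le> 1" if "w \<in> cball z d" for w
    using B[OF that] by (simp add: norm_inverse inverse_le_1_iff)
  ultimately have "norm (deriv (\<lambda>w. inverse (F w)) z) \<le> 1 / d" by (intro deriv_bound_ball d)
  moreover have "(F has_field_derivative deriv F z) (at z)"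
    using holomorphic_derivI[OF holomorphic_on_subset[OF hol ball_subset_cball], of z] d by simp
  then have "((\<lambda>w. inverse (F w)) has_field_derivative - (inverse (F z) * deriv F z * inverse (F z))) (at z)"
    using nz[OF z] by (rule DERIV_inverse')
  then have "deriv (\<lambda>w. inverse (F w)) z = - (inverse (F z) * deriv F z * inverse (F z))"
    by (rule DERIV_imp_deriv)
  ultimately have "norm (deriv F z) / (norm (F z))\<^sup>2 \<le> 1 / d"
    by (simp add: norm_mult norm_inverse divide_inverse power2_eq_square mult_ac)
  moreover have "spherical_deriv F z \<le> norm (deriv F z) / (norm (F z))\<^sup>2"
    unfolding spherical_deriv_def using nz[OF z] by (intro divide_left_mono) (auto intro!: mult_pos_pos add_pos_nonneg)
  ultimately show ?thesis by linarith
qed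

text \<open>
  On the sphere, the third coordinate tells whether the limit of a convergent subsequence is near
  infinity. If the limit at \<open>z\<close> is finite, the iterates are bounded near \<open>z\<close>; otherwise their reciprocals
  are. In both cases Cauchy's estimate bounds the spherical derivatives at \<open>z\<close>.
\<close>
lemma spherical_deriv_unbounded_in_julia_set:
  assumes hol: "f holomorphic_on UNIV" and unb: "\<And>M. \<forall>\<^sub>F n in sequentially. M < spherical_deriv (f ^^ n) z"
  shows "z \<in> julia_set f"
proof (rule ccontr)
  assume "z \<notin> julia_set f"
  then obtain U where U: "open U" "z \<in> U" "normal_family_on U (range (\<lambda>n::nat. f ^^ n))"
    unfolding julia_set_def by blast
  obtain r g where r: "strict_mono (r :: nat \<Rightarrow> nat)" and g: "\<And>K. compact K \<Longrightarrow> K \<subseteq> U \<Longrightarrow>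
     uniform_limit K (\<lambda>k w. sphere_point (Some ((f ^^ r k) w))) (\<lambda>w. sphere_point (g w)) sequentially"
    using U(3)[unfolded normal_family_on_def, rule_format, of "\<lambda>n. f ^^ n"] by blast
  obtain d where d: "d > 0" "cball z d \<subseteq> U" using U(1,2) open_contains_cball by blast
  have holn: "(f ^^ n) holomorphic_on S" for n S
    using funpow_holomorphic[OF hol] holomorphic_on_subset by blast
  note ul = g[OF compact_cball d(2)]
  have "continuous_on (cball z d) (\<lambda>w. sphere_point (g w))"
  proof (rule uniform_limit_theorem[OF _ ul])
    show "\<forall>\<^sub>F k in sequentially. continuous_on (cball z d) (\<lambda>w. sphere_point (Some ((f ^^ r k) w)))"
      by (intro always_eventually allI 
        continuous_on_compose2[OF continuous_on_sphere_point holomorphic_on_imp_continuous_on[OF holn]]) auto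
  qed simp
  then have cont: "continuous_on (cball z d) (\<lambda>w. snd (sphere_point (g w)))"
    by (rule continuous_on_snd)
  have near: "\<exists>d'>0. d' \<le> d \<and> (\<forall>\<^sub>F k in sequentially. \<forall>w\<in>cball z d'.
       \<bar>snd (sphere_point (Some ((f ^^ r k) w))) - snd (sphere_point (g z))\<bar> < e)" if e: "e > 0" for e
  proof -
    have zc: "z \<in> cball z d" using d by simp
    obtain d1 where d1: "d1 > 0" "\<And>w. w \<in> cball z d \<Longrightarrow> dist w z < d1 \<Longrightarrow> 
        dist (snd (sphere_point (g w))) (snd (sphere_point (g z))) < e / 2"
      using cont[unfolded continuous_on_iff, rule_format, OF zc, of "e / 2"] e by auto
    have "\<forall>\<^sub>F k in sequentially. \<forall>w\<in>cball z d. dist (sphere_point (Some ((f ^^ r k) w))) (sphere_point (g w)) < e / 2"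
      using uniform_limitD[OF ul, of "e / 2"] e by simp
    then have "\<forall>\<^sub>F k in sequentially. \<forall>w\<in>cball z (min d (d1 / 2)).
       \<bar>snd (sphere_point (Some ((f ^^ r k) w))) - snd (sphere_point (g z))\<bar> < e"
    proof eventually_elim
      case (elim k)
      show ?case
      proof
        fix w assume w: "w \<in> cball z (min d (d1 / 2))"
        then have "w \<in> cball z d" "dist w z < d1" using d1(1) by (auto simp: dist_commute)
        then have 1: "dist (snd (sphere_point (g w))) (snd (sphere_point (g z))) < e / 2" using d1(2) by blast
        have "dist (snd (sphere_point (Some ((f ^^ r k) w)))) (snd (sphere_point (g w))) < e / 2"
          using elim \<open>w \<in> cball z d\<close> dist_snd_le order_le_less_trans by blast
        with 1 show "\<bar>snd (sphere_point (Some ((f ^^ r k) w))) - snd (sphere_point (g z))\<bar> < e"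
          unfolding dist_real_def by linarith
      qed
    qed
    then show ?thesis using d d1 by (intro exI[of _ "min d (d1 / 2)"]) auto
  qed
  have "\<exists>C. \<forall>\<^sub>F k in sequentially. spherical_deriv (f ^^ r k) z \<le> C"
  proof (cases "g z")
    case None
    obtain d' where d': "d' > 0" "\<forall>\<^sub>F k in sequentially. \<forall>w\<in>cball z d'.
       \<bar>snd (sphere_point (Some ((f ^^ r k) w))) - snd (sphere_point (g z))\<bar> < 1"
      using near[of 1] by auto
    from d'(2) have "\<forall>\<^sub>F k in sequentially. spherical_deriv (f ^^ r k) z \<le> 1 / d'"
    proof eventually_elim
      case (elim k)
      show ?case
      proof (rule spherical_deriv_bound_large[OF holn d'(1)])
        fix w assume w: "w \<in> cball z d'"
        have "2 / ((norm ((f ^^ r k) w))\<^sup>2 + 1) < 1"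
          using elim w None unfolding snd_sphere_point by simp
        moreover have "(norm ((f ^^ r k) w))\<^sup>2 + 1 > 0" by (simp add: add_nonneg_pos)
        ultimately have "(norm ((f ^^ r k) w))\<^sup>2 > 1\<^sup>2" by (simp add: field_simps)
        then show "1 \<le> norm ((f ^^ r k) w)" by (meson less_imp_le norm_ge_zero power2_less_imp_less)
      qed
    qed
    then show ?thesis by blast
  next
    case (Some a)
    define e where "e = 1 / ((norm a)\<^sup>2 + 1)"
    have e: "e > 0" by (simp add: e_def add_nonneg_pos)
    have gz: "snd (sphere_point (g z)) = 1 - 2 * e" unfolding Some snd_sphere_point e_def by simp
    obtain d' where d': "d' > 0" "\<forall>\<^sub>F k in sequentially. \<forall>w\<in>cball z d'.
       \<bar>snd (sphere_point (Some ((f ^^ r k) w))) - snd (sphere_point (g z))\<bar> < e"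
      using near[OF e] by auto
    from d'(2) have "\<forall>\<^sub>F k in sequentially. spherical_deriv (f ^^ r k) z \<le> (2 / e) / d'"
    proof eventually_elim
      case (elim k)
      show ?case
      proof (rule spherical_deriv_bound_small[OF holn d'(1)])
        fix w assume w: "w \<in> cball z d'"
        let ?b = "norm ((f ^^ r k) w)"
        have "\<bar>1 - 2 / (?b\<^sup>2 + 1) - (1 - 2 * e)\<bar> < e"
          using bspec[OF elim w] unfolding snd_sphere_point gz .
        then have "2 / (?b\<^sup>2 + 1) > e" by linarith
        moreover have "?b\<^sup>2 + 1 > 0" by (simp add: add_nonneg_pos)
        ultimately have "?b\<^sup>2 + 1 < 2 / e" using e by (simp add: field_simps)
        moreover have "?b \<le> ?b\<^sup>2 + 1"
          using zero_le_power2[of "?b - 1 / 2"] by (simp add: power2_eq_square algebra_simps)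
        ultimately show "?b \<le> 2 / e" by linarith
      qed
    qed
    then show ?thesis by blast
  qed
  then obtain C where "\<forall>\<^sub>F k in sequentially. spherical_deriv (f ^^ r k) z \<le> C" by blast
  moreover have "\<forall>\<^sub>F k in sequentially. C < spherical_deriv (f ^^ r k) z"
    using eventually_subseq[OF r unb] .
  ultimately have "\<forall>\<^sub>F k in sequentially. False" by eventually_elim linarith
  then show False by simp
qed

lemma montel_subsequence:
  fixes p :: "nat \<Rightarrow> complex \<Rightarrow> complex"
  assumes V: "open V" "connected V" "w \<in> V"
    and hol: "\<And>k. p k holomorphic_on V" and omit: "\<And>k z. z \<in> V \<Longrightarrow> p k z \<noteq> 0 \<and> p k z \<noteq> 1"
    and le: "\<And>k. norm (p k w) \<le> 1"
  shows "\<exists>u r. strict_mono (r :: nat \<Rightarrow> nat) \<and> (\<forall>K. compact K \<and> K \<subseteq> V \<longrightarrow>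
    uniform_limit K (\<lambda>k. p (r k)) u sequentially \<and> (\<exists>B. \<forall>k. \<forall>z\<in>K. norm (p k z) \<le> B))"
proof -
  have bd: "\<exists>B. \<forall>h\<in>range p. \<forall>z\<in>K. norm (h z) \<le> B" if K: "compact K" "K \<subseteq> V" for K
  proof -
    obtain B where "\<And>h z. \<lbrakk>h \<in> range p; z \<in> K\<rbrakk> \<Longrightarrow> norm (h z) \<le> B"
      using GPicard3[OF V order_refl _ _ _ K, of "range p"] hol omit le by blast
    then show ?thesis by blast
  qed
  obtain u r where "u holomorphic_on V" and r: "strict_mono (r :: nat \<Rightarrow> nat)"
    and "\<And>x. x \<in> V \<Longrightarrow> ((\<lambda>n. p (r n) x) \<longlongrightarrow> u x) sequentially"
    and ul: "\<And>K. \<lbrakk>compact K; K \<subseteq> V\<rbrakk> \<Longrightarrow> uniform_limit K (p \<circ> r) u sequentially"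
    using Montel[OF V(1), of "range p" p] hol bd by blast
  show ?thesis
  proof (rule exI[of _ u], rule exI[of _ r], intro conjI allI impI r)
    fix K assume "compact K \<and> K \<subseteq> V"
    then have K: "compact K" "K \<subseteq> V" by auto
    show "uniform_limit K (\<lambda>k. p (r k)) u sequentially" using ul[OF K] by (simp add: o_def)
    show "\<exists>B. \<forall>k. \<forall>z\<in>K. norm (p k z) \<le> B" using bd[OF K] by blast
  qed
qed

text \<open>
  Multiplying numerators and denominators by \<open>\<bar>u\<bar>\<^sup>2\<close> gives formulas that make sense at \<open>u = 0\<close> as well.
\<close>
lemma continuous_on_sphere_point_affine_inverse:
  assumes c: "c \<noteq> 0"
  shows "continuous_on UNIV (\<lambda>u. sphere_point (if u = 0 then None else Some (a + c / u)))"
proof -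
  have den: "(norm u)\<^sup>2 + (norm (a * u + c))\<^sup>2 > 0" for u
    using c by (cases "u = 0") (auto intro: add_pos_nonneg)
  have "sphere_point (if u = 0 then None else Some (a + c / u)) =
      ((2 / ((norm u)\<^sup>2 + (norm (a * u + c))\<^sup>2)) *\<^sub>R ((a * u + c) * cnj u),
       ((norm (a * u + c))\<^sup>2 - (norm u)\<^sup>2) / ((norm u)\<^sup>2 + (norm (a * u + c))\<^sup>2))" for u
  proof (cases "u = 0")
    case True
    then show ?thesis using c by simp
  next
    case False
    define N where "N = a * u + c"
    have w: "a + c / u = N / u" using False by (simp add: N_def field_simps)
    have pos: "(norm u)\<^sup>2 > 0" "(norm u)\<^sup>2 + (norm N)\<^sup>2 > 0" using False by (auto intro: add_pos_nonneg)
    have 1: "1 + (norm (N / u))\<^sup>2 = ((norm u)\<^sup>2 + (norm N)\<^sup>2) / (norm u)\<^sup>2"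
      using pos by (simp add: norm_divide power_divide field_simps)
    have "of_real ((norm u)\<^sup>2) * (N / u) = N * cnj u"
      using False by (simp only: complex_norm_square) (simp add: field_simps)
    then have "(2 / (1 + (norm (N / u))\<^sup>2)) *\<^sub>R (N / u) = (2 / ((norm u)\<^sup>2 + (norm N)\<^sup>2)) *\<^sub>R (N * cnj u)"
      unfolding 1 scaleR_conv_of_real by (simp add: field_simps)
    moreover have "((norm (N / u))\<^sup>2 - 1) / ((norm (N / u))\<^sup>2 + 1) = ((norm N)\<^sup>2 - (norm u)\<^sup>2) / ((norm u)\<^sup>2 + (norm N)\<^sup>2)"
      using pos by (simp add: norm_divide power_divide divide_simps)
    ultimately show ?thesis using False unfolding w N_def[symmetric] by simp
  qed
  moreover have "continuous_on UNIV (\<lambda>u. ((2 / ((norm u)\<^sup>2 + (norm (a * u + c))\<^sup>2)) *\<^sub>R ((a * u + c) * cnj u),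
       ((norm (a * u + c))\<^sup>2 - (norm u)\<^sup>2) / ((norm u)\<^sup>2 + (norm (a * u + c))\<^sup>2)))"
    using den by (intro continuous_intros) (metis less_irrefl)+
  ultimately show ?thesis by simp
qed

text \<open>
  Montel's theorem for the spherical metric. After an affine normalization the omitted values are \<open>0\<close>
  and \<open>1\<close>, and then the reciprocals omit them too. Infinitely many of the functions, or of their
  reciprocals, are bounded by \<open>1\<close> at a base point; the Schottky bound makes these locally bounded, and
  a locally uniform limit of reciprocals is a spherical limit of the functions, with value infinity
  at its zeros.
\<close>
lemma normal_family_omitting_two_values:
  assumes V: "open V" "connected V" "V \<noteq> {}" and ab: "a \<noteq> b"
    and F: "\<And>h. h \<in> F \<Longrightarrow> h holomorphic_on V" "\<And>h z. h \<in> F \<Longrightarrow> z \<in> V \<Longrightarrow> h z \<noteq> a \<and> h z \<noteq> b"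
  shows "normal_family_on V F"
  unfolding normal_family_on_def
proof (intro allI impI)
  fix h :: "nat \<Rightarrow> complex \<Rightarrow> complex" assume h: "range h \<subseteq> F"
  obtain w where w: "w \<in> V" using V(3) by blast
  define c where "c = b - a"
  have c: "c \<noteq> 0" using ab by (simp add: c_def)
  define q where "q k z = (h k z - a) / c" for k z
  have hq: "h k z = a + c * q k z" for k z using c by (simp add: q_def)
  have hF: "h k holomorphic_on V" "z \<in> V \<Longrightarrow> h k z \<noteq> a \<and> h k z \<noteq> b" for k z using F h by blast+
  have holq: "q k holomorphic_on V" for k unfolding q_def using c by (intro holomorphic_intros hF)
  have q01: "q k z \<noteq> 0 \<and> q k z \<noteq> 1" if "z \<in> V" for k z
    using hF(2)[OF that, of k] c by (auto simp: q_def c_def)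
  have transfer: "\<exists>r g. strict_mono r \<and> (\<forall>K. compact K \<and> K \<subseteq> V \<longrightarrow>
      uniform_limit K (\<lambda>k z. sphere_point (Some (h (r k) z))) (\<lambda>z. sphere_point (g z)) sequentially)"
    if s: "strict_mono (s :: nat \<Rightarrow> nat)" and hol: "\<And>k. p k holomorphic_on V" 
      and omit: "\<And>k z. z \<in> V \<Longrightarrow> p k z \<noteq> 0 \<and> p k z \<noteq> 1" and le: "\<And>k. norm (p k w) \<le> 1"
      and cont: "continuous_on UNIV (\<lambda>u. sphere_point (\<Psi> u))"
      and eq: "\<And>k z. z \<in> V \<Longrightarrow> Some (h (s k) z) = \<Psi> (p k z)" for s p \<Psi>
  proof -
    obtain u r where r: "strict_mono (r :: nat \<Rightarrow> nat)"
      and lim: "\<forall>K. compact K \<and> K \<subseteq> V \<longrightarrow> uniform_limit K (\<lambda>k. p (r k)) u sequentially \<and>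
        (\<exists>B. \<forall>k. \<forall>z\<in>K. norm (p k z) \<le> B)"
    proof -
      have "\<exists>u r. strict_mono (r :: nat \<Rightarrow> nat) \<and> (\<forall>K. compact K \<and> K \<subseteq> V \<longrightarrow>
        uniform_limit K (\<lambda>k. p (r k)) u sequentially \<and> (\<exists>B. \<forall>k. \<forall>z\<in>K. norm (p k z) \<le> B))"
        by (rule montel_subsequence[OF V(1,2) w]) (fact hol omit le)+
      then show ?thesis using that by blast
    qed
    have "uniform_limit K (\<lambda>k z. sphere_point (Some (h ((s \<circ> r) k) z))) (\<lambda>z. sphere_point (\<Psi> (u z))) sequentially"
      if K: "compact K" "K \<subseteq> V" for K
    proof -
      note limK = lim[rule_format, OF conjI[OF K]]
      from conjunct2[OF limK] obtain B where B: "\<forall>k. \<forall>z\<in>K. norm (p k z) \<le> B" by (rule exE)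
      have "uniformly_continuous_on (cball 0 B) (\<lambda>u. sphere_point (\<Psi> u))"
        by (intro compact_uniformly_continuous continuous_on_subset[OF cont]) auto
      then have **: "uniform_limit K (\<lambda>k z. sphere_point (\<Psi> (p (r k) z))) (\<lambda>z. sphere_point (\<Psi> (u z))) sequentially"
      proof (rule uniform_limit_compose_uniformly_continuous_on[rotated])
        show "uniform_limit K (\<lambda>k. p (r k)) u sequentially" by (rule conjunct1[OF limK])
        show "\<forall>\<^sub>F k in sequentially. \<forall>z\<in>K. p (r k) z \<in> cball 0 B" using B by simp
      qed simp
      have *: "sphere_point (\<Psi> (p (r k) z)) = sphere_point (Some (h ((s \<circ> r) k) z))" if "z \<in> K" for k z
      proof -
        have "z \<in> V" using K that by blast
        then show ?thesis by (simp only: eq[of z "r k", symmetric] o_apply)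
      qed
      have "uniform_limit K (\<lambda>k z. sphere_point (\<Psi> (p (r k) z))) (\<lambda>z. sphere_point (\<Psi> (u z))) sequentially =
        uniform_limit K (\<lambda>k z. sphere_point (Some (h ((s \<circ> r) k) z))) (\<lambda>z. sphere_point (\<Psi> (u z))) sequentially"
        by (rule uniform_limit_cong'[OF * refl])
      with ** show ?thesis by (simp only:)
    qed
    then show ?thesis using strict_mono_o[OF s r] 
      by (intro exI[of _ "s \<circ> r"] exI[of _ "\<lambda>z. \<Psi> (u z)"]) blast
  qed
  show "\<exists>r g. strict_mono r \<and> (\<forall>K. compact K \<and> K \<subseteq> V \<longrightarrow>
      uniform_limit K (\<lambda>k z. sphere_point (Some (h (r k) z))) (\<lambda>z. sphere_point (g z)) sequentially)"
  proof (cases "infinite {k. norm (q k w) \<le> 1}")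
    case True
    then obtain s :: "nat \<Rightarrow> nat" where s: "strict_mono s" "\<And>k. norm (q (s k) w) \<le> 1"
      using infinite_enumerate by blast
    show ?thesis
    proof (rule transfer[OF s(1)])
      show "q (s k) holomorphic_on V" for k by (rule holq)
      show "q (s k) z \<noteq> 0 \<and> q (s k) z \<noteq> 1" if "z \<in> V" for k z using q01[OF that] .
      show "continuous_on UNIV (\<lambda>u. sphere_point (Some (a + c * u)))"
        by (rule continuous_on_compose2[OF continuous_on_sphere_point]) (auto intro!: continuous_intros)
      show "Some (h (s k) z) = Some (a + c * q (s k) z)" for k z using hq by simp
    qed (rule s(2))
  next
    case False
    then have "infinite (- {k. norm (q k w) \<le> 1})" 
      by (simp add: finite_Collect_not)
    then obtain s :: "nat \<Rightarrow> nat" where s: "strict_mono s" "\<And>k. norm (q (s k) w) > 1"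
      using infinite_enumerate[of "- {k. norm (q k w) \<le> 1}"] by (auto simp: not_le)
    show ?thesis
    proof (rule transfer[OF s(1)])
      show "(\<lambda>z. inverse (q (s k) z)) holomorphic_on V" for k
        using q01 by (intro holomorphic_intros holq) blast
      show "inverse (q (s k) z) \<noteq> 0 \<and> inverse (q (s k) z) \<noteq> 1" if "z \<in> V" for k z 
        using q01[OF that, of "s k"] inverse_eq_1_iff[of "q (s k) z"] by simp
      show "norm (inverse (q (s k) w)) \<le> 1" for k
        using s(2)[of k] by (simp add: norm_inverse inverse_le_1_iff)
      show "continuous_on UNIV (\<lambda>u. sphere_point (if u = 0 then None else Some (a + c / u)))"
        by (rule continuous_on_sphere_point_affine_inverse[OF c])
      show "Some (h (s k) z) = (if inverse (q (s k) z) = 0 then None else Some (a + c / inverse (q (s k) z)))"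
        if "z \<in> V" for k z
        using hq[of "s k" z] q01[OF that, of "s k"] by (simp add: divide_inverse)
    qed
  qed
qed

text \<open>
  In the proof \<open>X\<close> consists of the values omitted by the iterates on the ball and \<open>Y\<close> of the critical
  values of all iterates. An uncountable set is not covered by them.
\<close>
lemma expanding_points_near_julia_set:
  assumes hol: "f holomorphic_on UNIV" and log: "has_log_singularity_over_infinity f"
    and z: "z \<in> julia_set f" and e: "e > 0"
  shows "\<exists>v\<in>ball z e. expands_doubly_exponentially f v"
proof -
  define E where "E = {z. expands_doubly_exponentially f z}"
  have E: "uncountable E" unfolding E_def by (rule uncountable_expanding_points[OF hol log])
  define X where "X = - (\<Union>n. (f ^^ n) ` ball z e)"
  have X: "countable X"
  proof -
    have "a = b" if "a \<in> X" "b \<in> X" for a b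
    proof (rule ccontr)
      assume "a \<noteq> b"
      have "normal_family_on (ball z e) (range (\<lambda>n::nat. f ^^ n))"
      proof (rule normal_family_omitting_two_values[OF _ _ _ \<open>a \<noteq> b\<close>])
        show "h holomorphic_on ball z e" if "h \<in> range (\<lambda>n::nat. f ^^ n)" for h
          using that funpow_holomorphic[OF hol] holomorphic_on_subset by blast
        show "h u \<noteq> a \<and> h u \<noteq> b" if "h \<in> range (\<lambda>n::nat. f ^^ n)" "u \<in> ball z e" for h u
          using that \<open>a \<in> X\<close> \<open>b \<in> X\<close> unfolding X_def by blast
      qed (use e in auto)
      then have "z \<notin> julia_set f" unfolding julia_set_def using e 
        by (auto intro!: exI[of _ "ball z e"])
      then show False using z by blast
    qed
    then have "X = {} \<or> (\<exists>a. X = {a})" by blast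
    then show ?thesis by auto
  qed
  define Y where "Y = (\<Union>n. (f ^^ n) ` {v. deriv (f ^^ n) v = 0})"
  have Y: "countable Y"
  proof -
    obtain p where p: "expands_doubly_exponentially f p" 
    proof -
      have "E \<noteq> {}" using E by auto
      then show ?thesis using that unfolding E_def by blast
    qed
    have "countable {v. deriv (f ^^ n) v = 0}" for n
    proof (rule ccontr)
      assume "uncountable {v. deriv (f ^^ n) v = 0}"
      then have "deriv (f ^^ n) = (\<lambda>_. 0)"
        by (intro holomorphic_countable_equal_UNIV holomorphic_deriv funpow_holomorphic hol) auto
      then have n0: "deriv (f ^^ n) p = 0" by simp
      obtain N where N: "\<And>m. m \<ge> N \<Longrightarrow> 0 < spherical_deriv (f ^^ m) p"
        using expands_doubly_exponentially_unbounded[OF p, of 0] unfolding eventually_sequentially by blast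
      have "deriv (f ^^ (n + N)) p \<noteq> 0"
        using N[of "n + N"] by (auto simp: spherical_deriv_def)
      then have "deriv f ((f ^^ j) p) \<noteq> 0" if "j < n + N" for j
        using that unfolding deriv_funpow[OF hol] by simp
      then have "deriv (f ^^ n) p \<noteq> 0" unfolding deriv_funpow[OF hol] by simp
      then show False using n0 by simp
    qed
    then show ?thesis unfolding Y_def by blast
  qed
  have "uncountable (E - (X \<union> Y))" using E X Y by (intro uncountable_minus_countable) auto
  then have "E - (X \<union> Y) \<noteq> {}" using countable_empty by metis
  then obtain p where p: "p \<in> E" "p \<notin> X" "p \<notin> Y" by blast
  then obtain n v where v: "v \<in> ball z e" "p = (f ^^ n) v" unfolding X_def by blast
  then have nz: "deriv (f ^^ n) v \<noteq> 0" using p(3) unfolding Y_def by blast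
  have "expands_doubly_exponentially f ((f ^^ n) v)" using p(1) unfolding E_def v(2) by (rule CollectD)
  then have "expands_doubly_exponentially f v"
    using nz by (rule expands_doubly_exponentially_pullback[OF hol])
  then show ?thesis using v(1) by blast
qed

theorem corollary1p1:
  fixes f :: "complex \<Rightarrow> complex"
  assumes "transcendental_entire f"
    and "has_log_singularity_over_infinity f"
  shows "(top_of_set (julia_set f)) closure_of
           {z. (\<forall>\<^sub>F n in sequentially. spherical_deriv (f ^^ n) z > 1) \<and>
               liminf (\<lambda>n. ereal (1 / real n * ln (ln (spherical_deriv (f ^^ n) z))))
                 \<ge> ereal (ln (3 / 2))}
         = julia_set f"
proof -
  let ?G = "{z. (\<forall>\<^sub>F n in sequentially. spherical_deriv (f ^^ n) z > 1) \<and>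
               liminf (\<lambda>n. ereal (1 / real n * ln (ln (spherical_deriv (f ^^ n) z))))
                 \<ge> ereal (ln (3 / 2))}"
  have hol: "f holomorphic_on UNIV" using assms(1) unfolding transcendental_entire_def by blast
  have "z \<in> closure (julia_set f \<inter> ?G)" if z: "z \<in> julia_set f" for z
    unfolding closure_approachable
  proof (intro allI impI)
    fix e :: real assume "e > 0"
    then obtain v where v: "v \<in> ball z e" "expands_doubly_exponentially f v"
      using expanding_points_near_julia_set[OF hol assms(2) z] by blast
    have "v \<in> julia_set f"
      using spherical_deriv_unbounded_in_julia_set[OF hol expands_doubly_exponentially_unbounded[OF v(2)]] .
    moreover have "v \<in> ?G"
      using expands_doubly_exponentially_unbounded[OF v(2), of 1] expands_doubly_exponentially_liminf[OF v(2)] by blast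
    ultimately have "v \<in> julia_set f \<inter> ?G" by (rule IntI)
    moreover have "dist v z < e" using v(1) by (simp add: dist_commute)
    ultimately show "\<exists>y\<in>julia_set f \<inter> ?G. dist y z < e" by (rule bexI[rotated])
  qed
  then have "julia_set f \<subseteq> closure (julia_set f \<inter> ?G)" by (rule subsetI)
  then show ?thesis unfolding closure_of_subtopology euclidean_closure_of by (rule Int_absorb2)
qed

end
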